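(* There exists a $5$-dimensional connected real Lie group $L$ with a left-invariant nearly integrable $\mathrm{SO}(3)$ structure $(g,\mathbb T)$ of type $\Lambda^2_7$ whose torsion three-form $T$ is not closed, $dT\neq0$, and whose Lie algebra $\mathfrak l=\mathfrak h\oplus\mathfrak p$, with $\mathfrak h=\mathrm{span}\{e_1,e_2,e_4\}$ and $\mathfrak p=\mathrm{span}\{e_3,e_5\}$ in terms of the adapted frame $e_1,\dots,e_5$, satisfies $$[\mathfrak p,\mathfrak p]\subseteq\mathfrak p,\qquad[\mathfrak h,\mathfrak p]\subseteq\mathfrak h,\qquad[\mathfrak h,\mathfrak h]\subseteq\mathfrak p.$$
   Context: A left-invariant $\mathrm{SO}(3)$ structure on a $5$-dimensional Lie group $L$ is given by a basis $e_1,\dots,e_5$ of the Lie algebra $\mathfrak l$ (the adapted frame, viewed as left-invariant vector fields, with dual coframe $e^1,\dots,e^5$): $g=\sum_i (e^i)^2$, and $\mathbb T$ is the left-invariant totally symmetric covariant $3$-tensor with, for $X=\sum x_ie_i$, $$\mathbb T(X,X,X)=x_1\bigl(3x_2^2+3x_4^2-x_1^2-\tfrac32x_3^2-\tfrac32x_5^2\bigr)+\tfrac{3\sqrt3}{2}x_4(x_5^2-x_3^2)+3\sqrt3\,x_2x_3x_5 .$$ With $\nabla$ the Levi-Civita connection of $g$, the structure is nearly integrable if $(\nabla_X\mathbb T)(X,X,X)=0$ for all $X$. In that case there is a unique connection $\tilde\nabla$, called the characteristic connection, with $\tilde\nabla g=0$, $\tilde\nabla\mathbb T=0$ and totally skew-symmetric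 torsion; its torsion three-form is $T(X,Y,Z)=g(\tilde\nabla_XY-\tilde\nabla_YX-[X,Y],Z)$. Write $e^{ij}=e^i\wedge e^j$ and $E_1=\sqrt3e^{15}+e^{23}+e^{45}$, $E_2=\sqrt3e^{13}+e^{25}+e^{34}$, $E_3=2e^{24}+e^{35}$. Under $\mathrm{SO}(3)$ the two-forms split as $\Lambda^2=\Lambda^2_3\oplus\Lambda^2_7$ with $\Lambda^2_3=\mathrm{span}\{E_1,E_2,E_3\}$ and $\Lambda^2_7=(\Lambda^2_3)^\perp$. The structure has type $\Lambda^2_7$ if $*T\in\Lambda^2_7$ and $T\ne0$; here $*T\in\Lambda^2_7$ is equivalent to $T\wedge E_i=0$ for $i=1,2,3$. *)

theory Defs
  imports
    "HOL-Analysis.Analysis"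
    "HOL-Algebra.Group"
    "HOL-Library.Function_Algebras"
begin

text \<open>Sums, differences and products of real functions, of vector fields (operators on functions)
  and of tensors are the pointwise ones of \<^theory>\<open>HOL-Library.Function_Algebras\<close>.\<close>


section \<open>Smooth manifolds and Lie groups\<close>

text \<open>The set \<open>S\<close> is meant to be open.\<close>

fun Ck_on :: "nat \<Rightarrow> 'a::real_normed_vector set \<Rightarrow> ('a \<Rightarrow> 'b::real_normed_vector) \<Rightarrow> bool" where
  "Ck_on 0 S f \<longleftrightarrow> continuous_on S f"
| "Ck_on (Suc k) S f \<longleftrightarrow>
     (\<forall>x\<in>S. f differentiable (at x)) \<and> (\<forall>v. Ck_on k S (\<lambda>x. frechet_derivative f (at x) v))"

definition smooth_on :: "'a::real_normed_vector set \<Rightarrow> ('a \<Rightarrow> 'b::real_normed_vector) \<Rightarrow> bool" where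
  "smooth_on S f \<longleftrightarrow> (\<forall>k. Ck_on k S f)"

type_synonym ('a, 'm) atlas = "('a set \<times> ('a \<Rightarrow> 'm)) set"

text \<open>The underlying set of a manifold is a whole type. An atlas need not be maximal.\<close>

definition smooth_manifold :: "'a topology \<Rightarrow> ('a, 'm::euclidean_space) atlas \<Rightarrow> bool" where
  "smooth_manifold \<tau> A \<longleftrightarrow>
     topspace \<tau> = UNIV \<and> Hausdorff_space \<tau> \<and> second_countable \<tau> \<and>
     (\<Union>(U, \<phi>)\<in>A. U) = UNIV \<and>
     (\<forall>(U, \<phi>)\<in>A. openin \<tau> U \<and> open (\<phi> ` U) \<and>
        homeomorphic_map (subtopology \<tau> U) (top_of_set (\<phi> ` U)) \<phi>) \<and>
     (\<forall>(U, \<phi>)\<in>A. \<forall>(V, \<psi>)\<in>A. smooth_on (\<phi> ` (U \<inter> V)) (\<psi> \<circ> inv_into U \<phi>))"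

definition smooth_map ::
  "'a topology \<Rightarrow> ('a, 'm::euclidean_space) atlas \<Rightarrow> 'b topology \<Rightarrow> ('b, 'n::euclidean_space) atlas
     \<Rightarrow> ('a \<Rightarrow> 'b) \<Rightarrow> bool" where
  "smooth_map \<tau> A \<sigma> B f \<longleftrightarrow>
     continuous_map \<tau> \<sigma> f \<and>
     (\<forall>(U, \<phi>)\<in>A. \<forall>(V, \<psi>)\<in>B. smooth_on (\<phi> ` (U \<inter> f -` V)) (\<psi> \<circ> f \<circ> inv_into U \<phi>))"

definition prod_atlas :: "('a, 'm) atlas \<Rightarrow> ('b, 'n) atlas \<Rightarrow> ('a \<times> 'b, 'm \<times> 'n) atlas" where
  "prod_atlas A B = {(U \<times> V, map_prod \<phi> \<psi>) |U \<phi> V \<psi>. (U, \<phi>) \<in> A \<and> (V, \<psi>) \<in> B}"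

definition lie_group :: "'a monoid \<Rightarrow> 'a topology \<Rightarrow> ('a, 'm::euclidean_space) atlas \<Rightarrow> bool" where
  "lie_group G \<tau> A \<longleftrightarrow>
     group G \<and> carrier G = UNIV \<and> smooth_manifold \<tau> A \<and>
     smooth_map (prod_topology \<tau> \<tau>) (prod_atlas A A) \<tau> A (\<lambda>(x, y). x \<otimes>\<^bsub>G\<^esub> y) \<and>
     smooth_map \<tau> A \<tau> A (\<lambda>x. inv\<^bsub>G\<^esub> x)"


section \<open>Vector fields\<close>

definition smooth_functions :: "('a, 'm::euclidean_space) atlas \<Rightarrow> ('a \<Rightarrow> real) set" where
  "smooth_functions A = {f. \<forall>(U, \<phi>)\<in>A. smooth_on (\<phi> ` U) (f \<circ> inv_into U \<phi>)}"

type_synonym 'a vfield = "('a \<Rightarrow> real) \<Rightarrow> ('a \<Rightarrow> real)"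

text \<open>A vector field is the operator \<open>f \<mapsto> X f\<close> on smooth functions which in every chart is
  \<open>\<Sum>\<^sub>i a\<^sub>i \<partial>\<^sub>i\<close> with smooth coefficients. Its value on functions that are not smooth is normalised
  to \<open>0\<close>, so that equal vector fields are equal as operators.\<close>

definition vector_fields :: "('a, 'm::euclidean_space) atlas \<Rightarrow> 'a vfield set" where
  "vector_fields A = {X.
     (\<forall>f. f \<notin> smooth_functions A \<longrightarrow> X f = 0) \<and>
     (\<forall>(U, \<phi>)\<in>A. \<exists>a :: 'm \<Rightarrow> 'm. smooth_on (\<phi> ` U) a \<and>
        (\<forall>f\<in>smooth_functions A. \<forall>p\<in>U.
           X f p = frechet_derivative (f \<circ> inv_into U \<phi>) (at (\<phi> p)) (a (\<phi> p))))}"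

definition fscale :: "('a \<Rightarrow> real) \<Rightarrow> ('b \<Rightarrow> 'a \<Rightarrow> real) \<Rightarrow> ('b \<Rightarrow> 'a \<Rightarrow> real)"  (infixr "\<bullet>\<^sub>f" 75) where
  "h \<bullet>\<^sub>f X = (\<lambda>f. h * X f)"

definition bracket :: "'a vfield \<Rightarrow> 'a vfield \<Rightarrow> 'a vfield" where
  "bracket X Y = (\<lambda>f. X (Y f) - Y (X f))"

text \<open>Left-invariance: \<open>X (f \<circ> L\<^sub>a) = (X f) \<circ> L\<^sub>a\<close> for all left translations \<open>L\<^sub>a\<close>.\<close>

definition lie_algebra :: "'a monoid \<Rightarrow> ('a, 'm::euclidean_space) atlas \<Rightarrow> 'a vfield set" where
  "lie_algebra G A = {X \<in> vector_fields A.
     \<forall>a. \<forall>f\<in>smooth_functions A. X (\<lambda>p. f (a \<otimes>\<^bsub>G\<^esub> p)) = (\<lambda>p. X f (a \<otimes>\<^bsub>G\<^esub> p))}"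


section \<open>The adapted frame\<close>

text \<open>Frames are indexed by the numeral type \<open>5\<close>, whose elements are \<open>1, 2, 3, 4, 5\<close> (and \<open>5 = 0\<close>).\<close>

definition adapted_frame ::
  "'a monoid \<Rightarrow> ('a, 'm::euclidean_space) atlas \<Rightarrow> (5 \<Rightarrow> 'a vfield) \<Rightarrow> bool" where
  "adapted_frame G A e \<longleftrightarrow>
     (\<forall>i. e i \<in> lie_algebra G A) \<and>
     (\<forall>X\<in>lie_algebra G A. \<exists>!c :: 5 \<Rightarrow> real. X = (\<Sum>i\<in>UNIV. (\<lambda>p. c i) \<bullet>\<^sub>f e i))"

definition frame_span :: "(5 \<Rightarrow> 'a vfield) \<Rightarrow> 5 set \<Rightarrow> 'a vfield set" where
  "frame_span e I = {\<Sum>i\<in>I. (\<lambda>p. c i) \<bullet>\<^sub>f e i |c :: 5 \<Rightarrow> real. True}"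

text \<open>The dual coframe: the \<open>i\<close>-th component of \<open>coframe e X p\<close> is \<open>e\<^sup>i(X)\<close> at \<open>p\<close>, for any vector
  field \<open>X\<close>.\<close>

definition coframe :: "(5 \<Rightarrow> 'a vfield) \<Rightarrow> 'a vfield \<Rightarrow> 'a \<Rightarrow> real^5" where
  "coframe e X = (THE x. X = (\<Sum>i\<in>UNIV. (\<lambda>p. x p $ i) \<bullet>\<^sub>f e i))"


section \<open>The left-invariant SO(3) structure of a frame\<close>

definition metric :: "(5 \<Rightarrow> 'a vfield) \<Rightarrow> 'a vfield \<Rightarrow> 'a vfield \<Rightarrow> 'a \<Rightarrow> real" where
  "metric e X Y = (\<lambda>p. \<Sum>i\<in>UNIV. coframe e X p $ i * coframe e Y p $ i)"

definition cubic :: "real^5 \<Rightarrow> real" where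
  "cubic x = x$1 * (3 * (x$2)^2 + 3 * (x$4)^2 - (x$1)^2 - 3/2 * (x$3)^2 - 3/2 * (x$5)^2)
     + 3 * sqrt 3 / 2 * x$4 * ((x$5)^2 - (x$3)^2) + 3 * sqrt 3 * x$2 * x$3 * x$5"

text \<open>Polarisation, giving the symmetric trilinear form with \<open>polar x x x = cubic x\<close>.\<close>

definition polar :: "real^5 \<Rightarrow> real^5 \<Rightarrow> real^5 \<Rightarrow> real" where
  "polar x y z = (cubic (x + y + z) - cubic (x + y) - cubic (y + z) - cubic (x + z)
     + cubic x + cubic y + cubic z) / 6"

definition so3_tensor ::
  "(5 \<Rightarrow> 'a vfield) \<Rightarrow> 'a vfield \<Rightarrow> 'a vfield \<Rightarrow> 'a vfield \<Rightarrow> 'a \<Rightarrow> real" where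
  "so3_tensor e X Y Z = (\<lambda>p. polar (coframe e X p) (coframe e Y p) (coframe e Z p))"


section \<open>Connections\<close>

type_synonym 'a conn = "'a vfield \<Rightarrow> 'a vfield \<Rightarrow> 'a vfield"

definition affine_connection :: "('a, 'm::euclidean_space) atlas \<Rightarrow> 'a conn \<Rightarrow> bool" where
  "affine_connection A D \<longleftrightarrow>
     (\<forall>X\<in>vector_fields A. \<forall>Y\<in>vector_fields A. D X Y \<in> vector_fields A) \<and>
     (\<forall>X\<in>vector_fields A. \<forall>Y\<in>vector_fields A. \<forall>Z\<in>vector_fields A.
        D (X + Y) Z = D X Z + D Y Z \<and> D X (Y + Z) = D X Y + D X Z) \<and>
     (\<forall>h\<in>smooth_functions A. \<forall>X\<in>vector_fields A. \<forall>Y\<in>vector_fields A.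
        D (h \<bullet>\<^sub>f X) Y = h \<bullet>\<^sub>f D X Y \<and> D X (h \<bullet>\<^sub>f Y) = X h \<bullet>\<^sub>f Y + h \<bullet>\<^sub>f D X Y)"

definition metric_connection ::
  "('a, 'm::euclidean_space) atlas \<Rightarrow> (5 \<Rightarrow> 'a vfield) \<Rightarrow> 'a conn \<Rightarrow> bool" where
  "metric_connection A e D \<longleftrightarrow> affine_connection A D \<and>
     (\<forall>X\<in>vector_fields A. \<forall>Y\<in>vector_fields A. \<forall>Z\<in>vector_fields A.
        X (metric e Y Z) = metric e (D X Y) Z + metric e Y (D X Z))"

definition torsion :: "'a conn \<Rightarrow> 'a vfield \<Rightarrow> 'a vfield \<Rightarrow> 'a vfield" where
  "torsion D X Y = D X Y - D Y X - bracket X Y"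

definition levi_civita ::
  "('a, 'm::euclidean_space) atlas \<Rightarrow> (5 \<Rightarrow> 'a vfield) \<Rightarrow> 'a conn \<Rightarrow> bool" where
  "levi_civita A e D \<longleftrightarrow> metric_connection A e D \<and>
     (\<forall>X\<in>vector_fields A. \<forall>Y\<in>vector_fields A. torsion D X Y = 0)"

text \<open>\<open>cov_deriv D S W X Y Z\<close> is \<open>(D\<^sub>W S)(X, Y, Z)\<close>.\<close>

definition cov_deriv ::
  "'a conn \<Rightarrow> ('a vfield \<Rightarrow> 'a vfield \<Rightarrow> 'a vfield \<Rightarrow> 'a \<Rightarrow> real)
     \<Rightarrow> 'a vfield \<Rightarrow> 'a vfield \<Rightarrow> 'a vfield \<Rightarrow> 'a vfield \<Rightarrow> 'a \<Rightarrow> real" where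
  "cov_deriv D S W X Y Z = W (S X Y Z) - S (D W X) Y Z - S X (D W Y) Z - S X Y (D W Z)"

definition nearly_integrable ::
  "('a, 'm::euclidean_space) atlas \<Rightarrow> (5 \<Rightarrow> 'a vfield) \<Rightarrow> bool" where
  "nearly_integrable A e \<longleftrightarrow>
     (\<exists>D. levi_civita A e D \<and> (\<forall>X\<in>vector_fields A. cov_deriv D (so3_tensor e) X X X X = 0))"

definition torsion_form ::
  "(5 \<Rightarrow> 'a vfield) \<Rightarrow> 'a conn \<Rightarrow> 'a vfield \<Rightarrow> 'a vfield \<Rightarrow> 'a vfield \<Rightarrow> 'a \<Rightarrow> real" where
  "torsion_form e D X Y Z = metric e (torsion D X Y) Z"

definition characteristic_connection ::
  "('a, 'm::euclidean_space) atlas \<Rightarrow> (5 \<Rightarrow> 'a vfield) \<Rightarrow> 'a conn \<Rightarrow> bool" where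
  "characteristic_connection A e D \<longleftrightarrow> metric_connection A e D \<and>
     (\<forall>W\<in>vector_fields A. \<forall>X\<in>vector_fields A. \<forall>Y\<in>vector_fields A. \<forall>Z\<in>vector_fields A.
        cov_deriv D (so3_tensor e) W X Y Z = 0) \<and>
     (\<forall>X\<in>vector_fields A. \<forall>Y\<in>vector_fields A. \<forall>Z\<in>vector_fields A.
        torsion_form e D Y X Z = - torsion_form e D X Y Z \<and>
        torsion_form e D X Z Y = - torsion_form e D X Y Z)"


section \<open>Differential forms and the type of the torsion\<close>

text \<open>Exterior derivative of a three-form by the invariant formula.\<close>

definition ext_deriv3 ::
  "('a vfield \<Rightarrow> 'a vfield \<Rightarrow> 'a vfield \<Rightarrow> 'a \<Rightarrow> real)
     \<Rightarrow> 'a vfield \<Rightarrow> 'a vfield \<Rightarrow> 'a vfield \<Rightarrow> 'a vfield \<Rightarrow> 'a \<Rightarrow> real" where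
  "ext_deriv3 \<omega> W X Y Z =
     W (\<omega> X Y Z) - X (\<omega> W Y Z) + Y (\<omega> W X Z) - Z (\<omega> W X Y)
     - \<omega> (bracket W X) Y Z + \<omega> (bracket W Y) X Z - \<omega> (bracket W Z) X Y
     - \<omega> (bracket X Y) W Z + \<omega> (bracket X Z) W Y - \<omega> (bracket Y Z) W X"

type_synonym 'a form2 = "'a vfield \<Rightarrow> 'a vfield \<Rightarrow> 'a \<Rightarrow> real"

definition two_forms :: "('a, 'm::euclidean_space) atlas \<Rightarrow> 'a form2 set" where
  "two_forms A = {\<alpha>.
     (\<forall>X\<in>vector_fields A. \<forall>Y\<in>vector_fields A.
        \<alpha> X Y \<in> smooth_functions A \<and> \<alpha> Y X = - \<alpha> X Y) \<and>
     (\<forall>X\<in>vector_fields A. \<forall>Y\<in>vector_fields A. \<forall>Z\<in>vector_fields A.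
        \<alpha> (X + Y) Z = \<alpha> X Z + \<alpha> Y Z) \<and>
     (\<forall>h\<in>smooth_functions A. \<forall>X\<in>vector_fields A. \<forall>Y\<in>vector_fields A.
        \<alpha> (h \<bullet>\<^sub>f X) Y = h * \<alpha> X Y)}"

definition wedge2 :: "(5 \<Rightarrow> 'a vfield) \<Rightarrow> 5 \<Rightarrow> 5 \<Rightarrow> 'a form2" where
  "wedge2 e i j X Y = (\<lambda>p. coframe e X p $ i * coframe e Y p $ j - coframe e X p $ j * coframe e Y p $ i)"

definition form_scale :: "('a \<Rightarrow> real) \<Rightarrow> 'a form2 \<Rightarrow> 'a form2"  (infixr "\<bullet>\<^sub>2" 75) where
  "h \<bullet>\<^sub>2 \<alpha> = (\<lambda>X Y. h * \<alpha> X Y)"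

definition E1 :: "(5 \<Rightarrow> 'a vfield) \<Rightarrow> 'a form2" where
  "E1 e = (\<lambda>p. sqrt 3) \<bullet>\<^sub>2 wedge2 e 1 5 + wedge2 e 2 3 + wedge2 e 4 5"

definition E2 :: "(5 \<Rightarrow> 'a vfield) \<Rightarrow> 'a form2" where
  "E2 e = (\<lambda>p. sqrt 3) \<bullet>\<^sub>2 wedge2 e 1 3 + wedge2 e 2 5 + wedge2 e 3 4"

definition E3 :: "(5 \<Rightarrow> 'a vfield) \<Rightarrow> 'a form2" where
  "E3 e = (\<lambda>p. 2) \<bullet>\<^sub>2 wedge2 e 2 4 + wedge2 e 3 5"

text \<open>The pointwise inner product of two-forms for which the \<open>e\<^sup>i \<and> e\<^sup>j\<close>, \<open>i < j\<close>, are orthonormal;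
  the factor \<open>1/2\<close> comes from summing over all pairs \<open>(i, j)\<close>.\<close>

definition form_inner :: "(5 \<Rightarrow> 'a vfield) \<Rightarrow> 'a form2 \<Rightarrow> 'a form2 \<Rightarrow> 'a \<Rightarrow> real" where
  "form_inner e \<alpha> \<beta> = (\<lambda>p. 1/2 * (\<Sum>i\<in>UNIV. \<Sum>j\<in>UNIV. \<alpha> (e i) (e j) p * \<beta> (e i) (e j) p))"

definition Lambda2_3 :: "('a, 'm::euclidean_space) atlas \<Rightarrow> (5 \<Rightarrow> 'a vfield) \<Rightarrow> 'a form2 set" where
  "Lambda2_3 A e = {a \<bullet>\<^sub>2 E1 e + b \<bullet>\<^sub>2 E2 e + c \<bullet>\<^sub>2 E3 e |a b c.
     a \<in> smooth_functions A \<and> b \<in> smooth_functions A \<and> c \<in> smooth_functions A}"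

definition Lambda2_7 :: "('a, 'm::euclidean_space) atlas \<Rightarrow> (5 \<Rightarrow> 'a vfield) \<Rightarrow> 'a form2 set" where
  "Lambda2_7 A e = {\<alpha> \<in> two_forms A. \<forall>\<beta>\<in>Lambda2_3 A e. form_inner e \<alpha> \<beta> = 0}"

text \<open>The Hodge star of the three-form \<open>\<omega>\<close> with respect to \<open>g\<close> and the orientation \<open>e\<^sup>1\<^sup>2\<^sup>3\<^sup>4\<^sup>5\<close>: each \<open>e\<^sup>i\<^sup>j\<^sup>k\<close>,
  \<open>i < j < k\<close>, goes to \<open>\<plusminus> e\<^sup>l\<^sup>m\<close> with \<open>{l, m}\<close> the complementary indices and the sign such that
  \<open>e\<^sup>i\<^sup>j\<^sup>k \<and> *e\<^sup>i\<^sup>j\<^sup>k = e\<^sup>1\<^sup>2\<^sup>3\<^sup>4\<^sup>5\<close>.\<close>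

definition hodge_star3 ::
  "(5 \<Rightarrow> 'a vfield) \<Rightarrow> ('a vfield \<Rightarrow> 'a vfield \<Rightarrow> 'a vfield \<Rightarrow> 'a \<Rightarrow> real) \<Rightarrow> 'a form2" where
  "hodge_star3 e \<omega> =
       \<omega> (e 3) (e 4) (e 5) \<bullet>\<^sub>2 wedge2 e 1 2 - \<omega> (e 2) (e 4) (e 5) \<bullet>\<^sub>2 wedge2 e 1 3
     + \<omega> (e 2) (e 3) (e 5) \<bullet>\<^sub>2 wedge2 e 1 4 - \<omega> (e 2) (e 3) (e 4) \<bullet>\<^sub>2 wedge2 e 1 5
     + \<omega> (e 1) (e 4) (e 5) \<bullet>\<^sub>2 wedge2 e 2 3 - \<omega> (e 1) (e 3) (e 5) \<bullet>\<^sub>2 wedge2 e 2 4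
     + \<omega> (e 1) (e 3) (e 4) \<bullet>\<^sub>2 wedge2 e 2 5 + \<omega> (e 1) (e 2) (e 5) \<bullet>\<^sub>2 wedge2 e 3 4
     - \<omega> (e 1) (e 2) (e 4) \<bullet>\<^sub>2 wedge2 e 3 5 + \<omega> (e 1) (e 2) (e 3) \<bullet>\<^sub>2 wedge2 e 4 5"

definition type_Lambda2_7 ::
  "('a, 'm::euclidean_space) atlas \<Rightarrow> (5 \<Rightarrow> 'a vfield)
     \<Rightarrow> ('a vfield \<Rightarrow> 'a vfield \<Rightarrow> 'a vfield \<Rightarrow> 'a \<Rightarrow> real) \<Rightarrow> bool" where
  "type_Lambda2_7 A e T \<longleftrightarrow> hodge_star3 e T \<in> Lambda2_7 A e \<and>
     (\<exists>X\<in>vector_fields A. \<exists>Y\<in>vector_fields A. \<exists>Z\<in>vector_fields A. T X Y Z \<noteq> 0)"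

definition closed3 ::
  "('a, 'm::euclidean_space) atlas \<Rightarrow> ('a vfield \<Rightarrow> 'a vfield \<Rightarrow> 'a vfield \<Rightarrow> 'a \<Rightarrow> real) \<Rightarrow> bool" where
  "closed3 A T \<longleftrightarrow>
     (\<forall>W\<in>vector_fields A. \<forall>X\<in>vector_fields A. \<forall>Y\<in>vector_fields A. \<forall>Z\<in>vector_fields A.
        ext_deriv3 T W X Y Z = 0)"

definition bracket_in :: "'a vfield set \<Rightarrow> 'a vfield set \<Rightarrow> 'a vfield set \<Rightarrow> bool" where
  "bracket_in U V W \<longleftrightarrow> (\<forall>X\<in>U. \<forall>Y\<in>V. bracket X Y \<in> W)"

end

(* For a left-invariant frame and a connection whose Christoffel symbols \<Gamma> are constant in it, every
   condition becomes algebra on real^5. If all \<Gamma> x lie in so(3) and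
   \<Gamma> x y - \<Gamma> y x - [x, y] = T x y is totally skew, then \<Gamma> is the characteristic connection and
   \<Gamma> - T/2 the Levi-Civita connection, and near integrability is automatic because T x x = 0.
   Taking \<Gamma> and T as unknowns, type \<Lambda>\<^sup>2\<^sub>7 and the three inclusions are linear; the Jacobi identity has a
   solution with [h, h] = 0, so the group is a semidirect product of R^3 and the affine group of the
   line, which has a global chart. *)
theory Submission
  imports Defs
begin

section \<open>Smooth functions on a Euclidean space\<close>

text \<open>The conditions quantify over all vector fields, not only left-invariant ones. Writing a
  field by its coefficient functions in the frame makes them manageable: the derivatives of the
  coefficients cancel by the product rule, and only values at a point remain. The one analytic fact
  beyond the rules of differentiation is that second derivatives commute, which makes the commutator
  of two fields first order. The bracket is not chosen separately; it is
  \<open>\<Gamma> x y - \<Gamma> y x - T x y\<close>. The Jacobi identity is not verified by hand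
  either: an explicit group carries a frame with these structure constants. Its law comes from
  diagonalising \<open>ad e5\<close> on h. On the weight vectors U, e2, V of weights 2, 1, 0 the
  nilpotent map \<open>ad e3\<close> lowers the weight by one, so
  \<open>exp (p3 ad e3) exp (p5 ad e5)\<close> is polynomial in \<open>p3\<close> and
  \<open>exp p5\<close>. The point p stands for
  \<open>exp (p1 U + p2 e2 + p4 V) exp (p3 e3) exp (p5 e5)\<close>; thus \<open>p$1\<close> and
  \<open>p$4\<close> are coefficients of U and V, not of e1 and e4.\<close>

abbreviation deriv_at :: "('a::real_normed_vector \<Rightarrow> 'b::real_normed_vector) \<Rightarrow> 'a \<Rightarrow> 'a \<Rightarrow> 'b" where
  "deriv_at f x \<equiv> frechet_derivative f (at x)"

lemma deriv_at_eq: "(f has_derivative f') (at x) \<Longrightarrow> deriv_at f x = f'"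
  using frechet_derivative_at by metis

lemma Ck_on_SucD: "Ck_on (Suc k) S f \<Longrightarrow> Ck_on k S f"
proof (induction k arbitrary: f)
  case 0
  then show ?case
    by (auto intro!: continuous_at_imp_continuous_on differentiable_imp_continuous_within)
next
  case (Suc k)
  then show ?case by (metis Ck_on.simps(2))
qed

text \<open>\<open>Ck_on\<close> speaks of \<open>frechet_derivative\<close>, a choice that is
  pinned down only once some derivative is known; here the derivative may be given by any
  formula.\<close>

lemma Ck_on_SucI:
  assumes "\<And>x. (f has_derivative f' x) (at x)" and "\<And>v. Ck_on k UNIV (\<lambda>x. f' x v)"
  shows "Ck_on (Suc k) UNIV f"
  using assms deriv_at_eq[OF assms(1)] by (auto simp: differentiable_def)

lemma Ck_on_has_derivative:
  "Ck_on (Suc k) UNIV f \<Longrightarrow> (f has_derivative deriv_at f x) (at x)"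
  by (simp add: frechet_derivative_works[symmetric])

lemma Ck_on_const: "Ck_on k UNIV (\<lambda>x. c)"
  by (induction k arbitrary: c) auto

lemma Ck_on_bounded_linear:
  assumes "bounded_linear f"
  shows "Ck_on k UNIV f"
proof (cases k)
  case 0
  then show ?thesis by (simp add: assms linear_continuous_on)
next
  case (Suc j)
  show ?thesis unfolding Suc
    by (rule Ck_on_SucI[OF bounded_linear_imp_has_derivative[OF assms]]) (rule Ck_on_const)
qed

lemma Ck_on_add:
  "Ck_on k UNIV f \<Longrightarrow> Ck_on k UNIV g \<Longrightarrow> Ck_on k UNIV (\<lambda>x. f x + g x)"
proof (induction k arbitrary: f g)
  case 0
  then show ?case by (auto intro: continuous_intros)
next
  case (Suc k)
  show ?case
  proof (rule Ck_on_SucI)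
    show "((\<lambda>x. f x + g x) has_derivative (\<lambda>v. deriv_at f x v + deriv_at g x v)) (at x)" for x
      by (rule has_derivative_add[OF Suc.prems[THEN Ck_on_has_derivative]])
    show "Ck_on k UNIV (\<lambda>x. deriv_at f x v + deriv_at g x v)" for v
      using Suc by auto
  qed
qed

lemma Ck_on_bilinear:
  assumes "bounded_bilinear b"
  shows "Ck_on k UNIV f \<Longrightarrow> Ck_on k UNIV g \<Longrightarrow> Ck_on k UNIV (\<lambda>x. b (f x) (g x))"
proof (induction k arbitrary: f g)
  case 0
  then show ?case by (auto intro: bounded_bilinear.continuous_on[OF assms])
next
  case (Suc k)
  show ?case
  proof (rule Ck_on_SucI)
    show "((\<lambda>x. b (f x) (g x)) has_derivative
        (\<lambda>v. b (f x) (deriv_at g x v) + b (deriv_at f x v) (g x))) (at x)" for x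
      by (rule bounded_bilinear.FDERIV[OF assms Suc.prems[THEN Ck_on_has_derivative]])
    show "Ck_on k UNIV (\<lambda>x. b (f x) (deriv_at g x v) + b (deriv_at f x v) (g x))" for v
      using Suc.prems by (intro Ck_on_add Suc.IH Suc.prems[THEN Ck_on_SucD]) auto
  qed
qed

lemma Ck_on_exp: "Ck_on k UNIV f \<Longrightarrow> Ck_on k UNIV (\<lambda>x. exp (f x :: real))"
proof (induction k arbitrary: f)
  case 0
  then show ?case by (auto intro: continuous_intros)
next
  case (Suc k)
  show ?case
  proof (rule Ck_on_SucI)
    show "((\<lambda>x. exp (f x)) has_derivative (\<lambda>v. exp (f x) * deriv_at f x v)) (at x)" for x
      using has_derivative_exp[OF Ck_on_has_derivative[OF Suc.prems]] by (simp add: mult.commute)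
    show "Ck_on k UNIV (\<lambda>x. exp (f x) * deriv_at f x v)" for v
      using Suc.prems by (intro Ck_on_bilinear[OF bounded_bilinear_mult] Suc.IH Ck_on_SucD[OF Suc.prems]) auto
  qed
qed

lemma Ck_on_sum: "(\<And>i. i \<in> I \<Longrightarrow> Ck_on k UNIV (f i)) \<Longrightarrow> Ck_on k UNIV (\<lambda>x. \<Sum>i\<in>I. f i x)"
  by (induction I rule: infinite_finite_induct) (simp_all add: Ck_on_const Ck_on_add)

lemma linear_deriv_at: "Ck_on (Suc k) UNIV f \<Longrightarrow> bounded_linear (deriv_at f x)"
  using Ck_on_has_derivative has_derivative_bounded_linear by blast

lemma deriv_at_euclidean_representation:
  fixes f :: "'a::euclidean_space \<Rightarrow> 'b::real_normed_vector"
  assumes "Ck_on (Suc k) UNIV f"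
  shows "deriv_at f x v = (\<Sum>i\<in>Basis. (v \<bullet> i) *\<^sub>R deriv_at f x i)"
proof -
  interpret bounded_linear "deriv_at f x" by (rule linear_deriv_at[OF assms])
  show ?thesis by (subst euclidean_representation[of v, symmetric]) (simp add: sum scaleR)
qed

text \<open>Induction on the order with g fixed and f varying. The chain rule differentiates f in a
  direction that depends on the point, while \<open>Ck_on\<close> controls fixed directions only;
  expanding in a basis separates the two.\<close>

lemma Ck_on_compose:
  fixes g :: "'a::real_normed_vector \<Rightarrow> 'b::euclidean_space" and f :: "'b \<Rightarrow> 'c::real_normed_vector"
  shows "Ck_on k UNIV f \<Longrightarrow> Ck_on k UNIV g \<Longrightarrow> Ck_on k UNIV (\<lambda>x. f (g x))"
proof (induction k arbitrary: f)
  case 0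
  then show ?case by (auto intro: continuous_on_compose2)
next
  case (Suc k)
  show ?case
  proof (rule Ck_on_SucI)
    show "((\<lambda>x. f (g x)) has_derivative
        (\<lambda>v. \<Sum>i\<in>Basis. (deriv_at g x v \<bullet> i) *\<^sub>R deriv_at f (g x) i)) (at x)" for x
      using diff_chain_at[OF Ck_on_has_derivative[OF Suc.prems(2)] Ck_on_has_derivative[OF Suc.prems(1)]]
      by (simp add: o_def deriv_at_euclidean_representation[OF Suc.prems(1), symmetric])
    show "Ck_on k UNIV (\<lambda>x. \<Sum>i\<in>Basis. (deriv_at g x v \<bullet> i) *\<^sub>R deriv_at f (g x) i)" for v
    proof (intro Ck_on_sum Ck_on_bilinear[OF bounded_bilinear_scaleR])
      fix i :: 'b
      show "Ck_on k UNIV (\<lambda>x. deriv_at g x v \<bullet> i)"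
        using Suc.prems by (intro Ck_on_bilinear[OF bounded_bilinear_inner] Ck_on_const) auto
      show "Ck_on k UNIV (\<lambda>x. deriv_at f (g x) i)"
        using Suc.prems(1) by (intro Suc.IH Ck_on_SucD[OF Suc.prems(2)]) auto
    qed
  qed
qed

lemma smooth_onD: "smooth_on S f \<Longrightarrow> Ck_on k S f"
  by (simp add: smooth_on_def)

lemma smooth_has_derivative: "smooth_on UNIV f \<Longrightarrow> (f has_derivative deriv_at f x) (at x)"
  using Ck_on_has_derivative smooth_onD by blast

lemma smooth_bounded_linear_deriv: "smooth_on UNIV f \<Longrightarrow> bounded_linear (deriv_at f x)"
  using has_derivative_bounded_linear smooth_has_derivative by blast

lemma smooth_on_const: "smooth_on UNIV (\<lambda>x. c)"
  by (simp add: smooth_on_def Ck_on_const)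

lemma smooth_on_bounded_linear: "bounded_linear f \<Longrightarrow> smooth_on UNIV f"
  by (simp add: smooth_on_def Ck_on_bounded_linear)

lemma smooth_on_ident: "smooth_on UNIV (\<lambda>x. x)"
  by (simp add: smooth_on_bounded_linear bounded_linear_ident)

lemma smooth_on_add: "smooth_on UNIV f \<Longrightarrow> smooth_on UNIV g \<Longrightarrow> smooth_on UNIV (\<lambda>x. f x + g x)"
  by (simp add: smooth_on_def Ck_on_add)

lemma smooth_on_bilinear:
  "bounded_bilinear b \<Longrightarrow> smooth_on UNIV f \<Longrightarrow> smooth_on UNIV g \<Longrightarrow> smooth_on UNIV (\<lambda>x. b (f x) (g x))"
  by (simp add: smooth_on_def Ck_on_bilinear)

lemma smooth_on_mult:
  "smooth_on UNIV f \<Longrightarrow> smooth_on UNIV g \<Longrightarrow> smooth_on UNIV (\<lambda>x. f x * g x :: real)"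
  by (rule smooth_on_bilinear[OF bounded_bilinear_mult])

lemma smooth_on_linear_compose:
  "bounded_linear b \<Longrightarrow> smooth_on UNIV f \<Longrightarrow> smooth_on UNIV (\<lambda>x. b (f x))"
  using smooth_on_bilinear[of "\<lambda>(c::real) y. c *\<^sub>R b y" "\<lambda>x. 1" f]
    bounded_bilinear.comp[OF bounded_bilinear_scaleR bounded_linear_ident, of b]
  by (simp add: smooth_on_const)

lemma smooth_on_minus: "smooth_on UNIV f \<Longrightarrow> smooth_on UNIV (\<lambda>x. - f x)"
  using smooth_on_linear_compose[OF bounded_linear_minus[OF bounded_linear_ident]] .

lemma smooth_on_diff: "smooth_on UNIV f \<Longrightarrow> smooth_on UNIV g \<Longrightarrow> smooth_on UNIV (\<lambda>x. f x - g x)"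
  using smooth_on_add[OF _ smooth_on_minus, of f g] by simp

lemma smooth_on_power: "smooth_on UNIV f \<Longrightarrow> smooth_on UNIV (\<lambda>x. f x ^ n :: real)"
  by (induction n) (simp_all add: smooth_on_const smooth_on_mult)

lemma smooth_on_exp: "smooth_on UNIV f \<Longrightarrow> smooth_on UNIV (\<lambda>x. exp (f x :: real))"
  by (simp add: smooth_on_def Ck_on_exp)

lemma smooth_on_sum:
  "(\<And>i. i \<in> I \<Longrightarrow> smooth_on UNIV (f i)) \<Longrightarrow> smooth_on UNIV (\<lambda>x. \<Sum>i\<in>I. f i x)"
  by (simp add: smooth_on_def Ck_on_sum)

lemma smooth_on_compose:
  fixes g :: "'a::real_normed_vector \<Rightarrow> 'b::euclidean_space"
  shows "smooth_on UNIV f \<Longrightarrow> smooth_on UNIV g \<Longrightarrow> smooth_on UNIV (\<lambda>x. f (g x))"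
  by (simp add: smooth_on_def Ck_on_compose)

lemma smooth_on_vec_nth: "smooth_on UNIV f \<Longrightarrow> smooth_on UNIV (\<lambda>x. f x $ i)"
  by (rule smooth_on_linear_compose[OF bounded_linear_vec_nth])

lemma smooth_on_vecI:
  fixes f :: "'a::real_normed_vector \<Rightarrow> real ^ 'n"
  assumes "\<And>i. smooth_on UNIV (\<lambda>x. f x $ i)"
  shows "smooth_on UNIV f"
proof -
  have "f = (\<lambda>x. \<Sum>i\<in>UNIV. f x $ i *\<^sub>R axis i 1)"
    by (simp add: fun_eq_iff vec_eq_iff axis_def if_distrib cong: if_cong)
  moreover have "smooth_on UNIV (\<lambda>x. \<Sum>i\<in>UNIV. f x $ i *\<^sub>R (axis i 1 :: real ^ 'n))"
    by (intro smooth_on_sum smooth_on_bilinear[OF bounded_bilinear_scaleR] assms smooth_on_const)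
  ultimately show ?thesis by simp
qed

lemma smooth_on_deriv_at: "smooth_on UNIV f \<Longrightarrow> smooth_on UNIV (\<lambda>x. deriv_at f x v)"
  unfolding smooth_on_def by (metis Ck_on.simps(2))

lemma smooth_on_directional_deriv:
  fixes f :: "'a::euclidean_space \<Rightarrow> 'b::real_normed_vector"
  assumes "smooth_on UNIV f" "smooth_on UNIV a"
  shows "smooth_on UNIV (\<lambda>x. deriv_at f x (a x))"
  by (subst deriv_at_euclidean_representation[OF smooth_onD[OF assms(1), of "Suc 0"]])
    (intro smooth_on_sum smooth_on_bilinear[OF bounded_bilinear_scaleR]
      smooth_on_bilinear[OF bounded_bilinear_inner] smooth_on_deriv_at assms smooth_on_const)

section \<open>Symmetry of second derivatives\<close>

lemma second_difference:
  fixes f :: "'a::real_normed_vector \<Rightarrow> real"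
  assumes "Ck_on (Suc (Suc k)) UNIV f" and "s > 0"
  shows "\<exists>\<xi>\<in>{0<..<s}. \<exists>\<eta>\<in>{0<..<s}.
    f (p + s *\<^sub>R v + s *\<^sub>R w) - f (p + s *\<^sub>R v) - f (p + s *\<^sub>R w) + f p
      = s * s * deriv_at (\<lambda>x. deriv_at f x v) (p + \<xi> *\<^sub>R v + \<eta> *\<^sub>R w) w"
proof -
  have along: "((\<lambda>\<tau>. g (q + \<tau> *\<^sub>R u)) has_real_derivative deriv_at g (q + \<tau> *\<^sub>R u) u) (at \<tau>)"
    if "Ck_on (Suc j) UNIV g" for g :: "'a \<Rightarrow> real" and j q u \<tau>
  proof -
    have "((\<lambda>\<tau>. q + \<tau> *\<^sub>R u) has_derivative (\<lambda>h. h *\<^sub>R u)) (at \<tau>)"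
      by (auto intro!: derivative_eq_intros)
    from diff_chain_at[OF this Ck_on_has_derivative[OF that]]
    show ?thesis
      by (simp add: o_def has_field_derivative_def mult_commute_abs
          linear.scaleR[OF bounded_linear.linear[OF linear_deriv_at[OF that]]])
  qed
  \<comment> \<open>The mean value theorem is used twice: in the direction v for the difference
    across w, then in the direction w for the derivative along v.\<close>
  define g where "g \<tau> = f (p + s *\<^sub>R w + \<tau> *\<^sub>R v) - f (p + \<tau> *\<^sub>R v)" for \<tau>
  have dg: "(g has_real_derivative
      deriv_at f (p + s *\<^sub>R w + \<tau> *\<^sub>R v) v - deriv_at f (p + \<tau> *\<^sub>R v) v) (at \<tau>)" for \<tau>
    unfolding g_def[abs_def] by (intro DERIV_diff along[OF assms(1)])
  obtain \<xi> where \<xi>: "0 < \<xi>" "\<xi> < s" and g: "g s - g 0 =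
      s * (deriv_at f (p + s *\<^sub>R w + \<xi> *\<^sub>R v) v - deriv_at f (p + \<xi> *\<^sub>R v) v)"
    using MVT2[OF \<open>s > 0\<close> dg] by auto
  define h where "h \<tau> = deriv_at f (p + \<xi> *\<^sub>R v + \<tau> *\<^sub>R w) v" for \<tau>
  have dh: "(h has_real_derivative
      deriv_at (\<lambda>x. deriv_at f x v) (p + \<xi> *\<^sub>R v + \<tau> *\<^sub>R w) w) (at \<tau>)" for \<tau>
    unfolding h_def[abs_def] using assms(1) by (intro along[of k]) simp
  obtain \<eta> where \<eta>: "0 < \<eta>" "\<eta> < s" and h: "h s - h 0 =
      s * deriv_at (\<lambda>x. deriv_at f x v) (p + \<xi> *\<^sub>R v + \<eta> *\<^sub>R w) w"
    using MVT2[OF \<open>s > 0\<close> dh] by auto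
  have "f (p + s *\<^sub>R v + s *\<^sub>R w) - f (p + s *\<^sub>R v) - f (p + s *\<^sub>R w) + f p = g s - g 0"
    by (simp add: g_def algebra_simps)
  also have "\<dots> = s * (h s - h 0)" by (simp add: g h_def algebra_simps)
  finally have "f (p + s *\<^sub>R v + s *\<^sub>R w) - f (p + s *\<^sub>R v) - f (p + s *\<^sub>R w) + f p
      = s * s * deriv_at (\<lambda>x. deriv_at f x v) (p + \<xi> *\<^sub>R v + \<eta> *\<^sub>R w) w"
    by (simp only: h mult.assoc)
  then show ?thesis using \<xi> \<eta> by (intro bexI[of _ \<xi>] bexI[of _ \<eta>]) auto
qed

text \<open>The second difference over a small parallelogram is symmetric in v and w. It is
  \<open>s * s\<close> times either mixed derivative at some point near p, and continuity then
  leaves no room for the two to differ.\<close>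

lemma symmetric_second_derivative:
  fixes f :: "'a::real_normed_vector \<Rightarrow> real"
  assumes f: "Ck_on (Suc (Suc 0)) UNIV f"
  shows "deriv_at (\<lambda>x. deriv_at f x v) p w = deriv_at (\<lambda>x. deriv_at f x w) p v"
proof (rule ccontr)
  define F where "F v w x = deriv_at (\<lambda>x. deriv_at f x v) x w" for v w x
  assume "\<not> ?thesis"
  then have "dist (F v w p) (F w v p) / 2 > 0" (is "?\<epsilon> > 0") by (simp add: F_def)
  moreover have "isCont (F v w) p" for v w
    using f by (simp add: F_def[abs_def] continuous_on_eq_continuous_at)
  ultimately have "\<forall>\<^sub>F x in nhds p. dist (F v w x) (F v w p) < ?\<epsilon>" for v w
    by (metis tendstoD isCont_def tendsto_at_iff_tendsto_nhds)
  from eventually_conj[OF this[of v w] this[of w v]]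
  obtain d where "d > 0" and d: "\<And>x. dist x p < d \<Longrightarrow>
      dist (F v w x) (F v w p) < ?\<epsilon> \<and> dist (F w v x) (F w v p) < ?\<epsilon>"
    by (auto simp: eventually_nhds_metric)
  \<comment> \<open>Small enough for all points of the parallelogram in question to lie within
    distance d of p; the summand 1 covers v = w = 0.\<close>
  define s where "s = d / (norm v + norm w + 1)"
  have pos: "norm v + norm w + 1 > 0" by (simp add: add_nonneg_pos)
  then have "s > 0" using \<open>d > 0\<close> by (simp add: s_def)
  have near: "dist (p + \<xi> *\<^sub>R v + \<eta> *\<^sub>R w) p < d" "dist (p + \<eta> *\<^sub>R w + \<xi> *\<^sub>R v) p < d"
    if "\<xi> \<in> {0<..<s}" "\<eta> \<in> {0<..<s}" for \<xi> \<eta>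
  proof -
    have "norm (\<xi> *\<^sub>R v + \<eta> *\<^sub>R w) \<le> \<xi> * norm v + \<eta> * norm w"
      using that by (metis abs_of_pos greaterThanLessThan_iff norm_scaleR norm_triangle_ineq)
    also have "\<dots> \<le> s * norm v + s * norm w"
      using that by (intro add_mono mult_right_mono) auto
    also have "\<dots> < s * (norm v + norm w + 1)" using \<open>s > 0\<close> by (simp add: algebra_simps)
    also have "\<dots> = d" using pos by (simp add: s_def)
    finally have "norm (\<xi> *\<^sub>R v + \<eta> *\<^sub>R w) < d" .
    then show "dist (p + \<xi> *\<^sub>R v + \<eta> *\<^sub>R w) p < d" "dist (p + \<eta> *\<^sub>R w + \<xi> *\<^sub>R v) p < d"
      by (simp_all add: dist_norm add.commute add.left_commute)
  qed
  obtain \<xi> \<eta> where 1: "\<xi> \<in> {0<..<s}" "\<eta> \<in> {0<..<s}"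
    and e1: "f (p + s *\<^sub>R v + s *\<^sub>R w) - f (p + s *\<^sub>R v) - f (p + s *\<^sub>R w) + f p
      = s * s * F v w (p + \<xi> *\<^sub>R v + \<eta> *\<^sub>R w)"
    using second_difference[OF f \<open>s > 0\<close>, of p v w] unfolding F_def by blast
  obtain \<xi>' \<eta>' where 2: "\<xi>' \<in> {0<..<s}" "\<eta>' \<in> {0<..<s}"
    and e2: "f (p + s *\<^sub>R w + s *\<^sub>R v) - f (p + s *\<^sub>R w) - f (p + s *\<^sub>R v) + f p
      = s * s * F w v (p + \<xi>' *\<^sub>R w + \<eta>' *\<^sub>R v)"
    using second_difference[OF f \<open>s > 0\<close>, of p w v] unfolding F_def by blast
  have "p + s *\<^sub>R v + s *\<^sub>R w = p + s *\<^sub>R w + s *\<^sub>R v" by simp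
  then have "s * s * F v w (p + \<xi> *\<^sub>R v + \<eta> *\<^sub>R w) = s * s * F w v (p + \<xi>' *\<^sub>R w + \<eta>' *\<^sub>R v)"
    using e1 e2 by (simp only:)
  then have "F v w (p + \<xi> *\<^sub>R v + \<eta> *\<^sub>R w) = F w v (p + \<xi>' *\<^sub>R w + \<eta>' *\<^sub>R v)"
    using \<open>s > 0\<close> by simp
  moreover have "dist (F v w (p + \<xi> *\<^sub>R v + \<eta> *\<^sub>R w)) (F v w p) < ?\<epsilon>" using d near(1)[OF 1] by blast
  moreover have "dist (F w v (p + \<xi>' *\<^sub>R w + \<eta>' *\<^sub>R v)) (F w v p) < ?\<epsilon>"
    using d near(2)[OF 2(2) 2(1)] by blast
  ultimately show False
    using dist_triangle3[of "F v w p" "F w v p" "F v w (p + \<xi> *\<^sub>R v + \<eta> *\<^sub>R w)"] by simp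
qed

section \<open>Vectors with five components\<close>

lemma exhaust_5: "i = 1 \<or> i = 2 \<or> i = 3 \<or> i = 4 \<or> i = 5" for i :: 5
proof (induct i)
  case (of_int z)
  have "0 \<le> z" "z < 5" using of_int by simp_all
  \<comment> \<open>The representatives are 0 to 4, and 0 is the index 5.\<close>
  then consider "z = 0" | "z = 1" | "z = 2" | "z = 3" | "z = 4" by linarith
  then show ?case by cases simp_all
qed

lemma UNIV_5: "(UNIV :: 5 set) = {1, 2, 3, 4, 5}"
  using exhaust_5 by auto

lemma sum_5: "sum f (UNIV :: 5 set) = f 1 + f 2 + f 3 + f 4 + f 5"
  unfolding UNIV_5 by (simp add: ac_simps)

lemma forall_5: "(\<forall>i::5. P i) \<longleftrightarrow> P 1 \<and> P 2 \<and> P 3 \<and> P 4 \<and> P 5"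
  by (metis exhaust_5)

definition vec5 :: "'a \<Rightarrow> 'a \<Rightarrow> 'a \<Rightarrow> 'a \<Rightarrow> 'a \<Rightarrow> 'a ^ 5" where
  "vec5 a b c d e = (\<chi> i. if i = 1 then a else if i = 2 then b else if i = 3 then c else if i = 4 then d else e)"

lemma vec5_nth [simp]:
  "vec5 a b c d e $ 1 = a" "vec5 a b c d e $ 2 = b" "vec5 a b c d e $ 3 = c"
  "vec5 a b c d e $ 4 = d" "vec5 a b c d e $ 5 = e"
  by (simp_all add: vec5_def)

lemma vec5_eq_iff: "v = w \<longleftrightarrow> v $ 1 = w $ 1 \<and> v $ 2 = w $ 2 \<and> v $ 3 = w $ 3 \<and> v $ 4 = w $ 4 \<and> v $ 5 = w $ 5"
  for v w :: "'a ^ 5"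
  by (simp add: vec_eq_iff forall_5)

lemma inner_5: "v \<bullet> w = v $ 1 * w $ 1 + v $ 2 * w $ 2 + v $ 3 * w $ 3 + v $ 4 * w $ 4 + v $ 5 * w $ 5"
  for v w :: "real ^ 5"
  by (simp add: inner_vec_def sum_5)

lemma smooth_on_vec5:
  fixes a b c d e :: "'a::real_normed_vector \<Rightarrow> real"
  assumes "smooth_on UNIV a" "smooth_on UNIV b" "smooth_on UNIV c" "smooth_on UNIV d" "smooth_on UNIV e"
  shows "smooth_on UNIV (\<lambda>x. vec5 (a x) (b x) (c x) (d x) (e x))"
proof (rule smooth_on_vecI)
  show "smooth_on UNIV (\<lambda>x. vec5 (a x) (b x) (c x) (d x) (e x) $ i)" for i
    using exhaust_5[of i] assms by (elim disjE) simp_all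
qed

lemma has_derivative_vec5:
  assumes "(a has_derivative a') (at x)" "(b has_derivative b') (at x)" "(c has_derivative c') (at x)"
    "(d has_derivative d') (at x)" "(e has_derivative e') (at x)"
  shows "((\<lambda>x. vec5 (a x) (b x) (c x) (d x) (e x)) has_derivative
    (\<lambda>v. vec5 (a' v) (b' v) (c' v) (d' v) (e' v :: real))) (at x)"
proof -
  have "((\<lambda>x. vec5 (a x) (b x) (c x) (d x) (e x) $ i) has_derivative
    (\<lambda>v. vec5 (a' v) (b' v) (c' v) (d' v) (e' v) $ i)) (at x)" for i
    using exhaust_5[of i] assms by (elim disjE) simp_all
  then show ?thesis
    by (subst has_derivative_componentwise_within) (auto simp: Basis_vec_def inner_axis)
qed

lemma bounded_bilinearI:
  fixes b :: "'a::euclidean_space \<Rightarrow> 'b::euclidean_space \<Rightarrow> 'c::real_normed_vector"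
  assumes "\<And>x y z. b (x + y) z = b x z + b y z" "\<And>x y z. b x (y + z) = b x y + b x z"
    and "\<And>s x y. b (s *\<^sub>R x) y = s *\<^sub>R b x y" "\<And>s x y. b x (s *\<^sub>R y) = s *\<^sub>R b x y"
  shows "bounded_bilinear b"
  unfolding bilinear_conv_bounded_bilinear[symmetric] bilinear_def
  by (auto intro!: linearI simp: assms)

subsection \<open>The cubic form\<close>

text \<open>The vector representing the linear form \<open>\<lambda>x. polar x y z\<close>. It
  trades a trilinear form for a bilinear map, to which the rules for \<open>bounded_bilinear\<close>
  apply; \<open>3 *\<^sub>R polar_grad x x\<close> is the gradient of the cubic.\<close>

definition polar_grad :: "real^5 \<Rightarrow> real^5 \<Rightarrow> real^5" where
  "polar_grad y z = vec5
     (y$2 * z$2 + y$4 * z$4 - y$1 * z$1 - (y$3 * z$3 + y$5 * z$5) / 2)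
     (y$1 * z$2 + y$2 * z$1 + sqrt 3 / 2 * (y$3 * z$5 + y$5 * z$3))
     (sqrt 3 / 2 * (y$2 * z$5 + y$5 * z$2 - y$4 * z$3 - y$3 * z$4) - (y$1 * z$3 + y$3 * z$1) / 2)
     (y$1 * z$4 + y$4 * z$1 + sqrt 3 / 2 * (y$5 * z$5 - y$3 * z$3))
     (sqrt 3 / 2 * (y$4 * z$5 + y$5 * z$4 + y$2 * z$3 + y$3 * z$2) - (y$1 * z$5 + y$5 * z$1) / 2)"

lemma bounded_bilinear_polar_grad: "bounded_bilinear polar_grad"
  by (rule bounded_bilinearI) (simp_all add: polar_grad_def vec5_eq_iff algebra_simps add_divide_distrib)

lemma polar_grad_commute: "x \<bullet> polar_grad y z = y \<bullet> polar_grad x z" "polar_grad y z = polar_grad z y"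
  by (simp_all add: polar_grad_def inner_5 vec5_eq_iff algebra_simps add_divide_distrib)

lemma cubic_eq_inner: "cubic x = x \<bullet> polar_grad x x"
  unfolding cubic_def polar_grad_def inner_5
  by (simp add: algebra_simps power2_eq_square add_divide_distrib)

lemma polar_eq_inner: "polar x y z = x \<bullet> polar_grad y z"
proof -
  interpret bounded_bilinear polar_grad by (rule bounded_bilinear_polar_grad)
  have sym: "a \<bullet> polar_grad b c = b \<bullet> polar_grad a c" "a \<bullet> polar_grad b c = a \<bullet> polar_grad c b" for a b c
    using polar_grad_commute by metis+
  \<comment> \<open>After trilinear expansion the summands differ by permutations of their
    arguments. These instances identify them, and all but six copies of
    \<open>x \<bullet> polar_grad y z\<close> cancel.\<close>
  show ?thesis
    using sym[of x y z] sym[of y x z] sym[of z x y] sym[of x x y] sym[of x x z] sym[of y y x] sym[of y y z]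
      sym[of z z x] sym[of z z y] sym[of x y x] sym[of x z x] sym[of y z y] sym[of y x y] sym[of z x z] sym[of z y z]
    by (simp add: polar_def cubic_eq_inner add_left add_right inner_add_left inner_add_right)
qed

lemma polar_commute: "polar x y z = polar y x z" "polar x y z = polar x z y"
  by (simp_all add: polar_def add.commute add.left_commute)

lemma polar_has_derivative:
  assumes "(x has_derivative x') (at p)" "(y has_derivative y') (at p)" "(z has_derivative z') (at p)"
  shows "((\<lambda>p. polar (x p) (y p) (z p)) has_derivative
    (\<lambda>v. polar (x' v) (y p) (z p) + polar (x p) (y' v) (z p) + polar (x p) (y p) (z' v))) (at p)"
  using has_derivative_inner[OF assms(1) bounded_bilinear.FDERIV[OF bounded_bilinear_polar_grad assms(2,3)]]
  by (simp add: polar_eq_inner inner_add_right add.commute add.left_commute add.assoc)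

lemma polar_add: "polar (x + x') y z = polar x y z + polar x' y z"
  "polar x (y + y') z = polar x y z + polar x y' z"
  "polar x y (z + z') = polar x y z + polar x y z'"
  using bounded_bilinear.add_left[OF bounded_bilinear_polar_grad]
    bounded_bilinear.add_right[OF bounded_bilinear_polar_grad]
  by (simp_all add: polar_eq_inner inner_add_left inner_add_right)

lemma smooth_on_polar:
  assumes "smooth_on UNIV x" "smooth_on UNIV y" "smooth_on UNIV z"
  shows "smooth_on UNIV (\<lambda>p. polar (x p) (y p) (z p))"
  unfolding polar_eq_inner
  by (intro smooth_on_bilinear[OF bounded_bilinear_inner]
      smooth_on_bilinear[OF bounded_bilinear_polar_grad] assms)

section \<open>Vector fields in a single global chart\<close>

abbreviation std_atlas :: "('a, 'a::euclidean_space) atlas" where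
  "std_atlas \<equiv> {(UNIV, id)}"

lemma smooth_functions_std: "smooth_functions std_atlas = {f. smooth_on UNIV f}"
  by (simp add: smooth_functions_def)

text \<open>Encodes a field by its coefficient function, with the same value 0 on non-smooth
  functions as in \<open>vector_fields\<close>; equality of operators thereby becomes equality of
  coefficients.\<close>

definition vf :: "('a::euclidean_space \<Rightarrow> 'a) \<Rightarrow> 'a vfield" where
  "vf a f = (if smooth_on UNIV f then (\<lambda>p. deriv_at f p (a p)) else 0)"

lemma vector_fields_std: "vector_fields std_atlas = {vf a |a. smooth_on UNIV a}"
proof (intro equalityI subsetI)
  fix X :: "'a vfield"
  assume "X \<in> vector_fields std_atlas"
  then obtain a where "smooth_on UNIV a" and
    "\<And>f. \<not> smooth_on UNIV f \<Longrightarrow> X f = 0" "\<And>f p. smooth_on UNIV f \<Longrightarrow> X f p = deriv_at f p (a p)"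
    by (auto simp: vector_fields_def smooth_functions_std)
  moreover from this have "X = vf a" by (auto simp: vf_def fun_eq_iff)
  ultimately show "X \<in> {vf a |a. smooth_on UNIV a}" by blast
qed (auto simp: vector_fields_def smooth_functions_std vf_def)

lemma vf_smooth: "smooth_on UNIV f \<Longrightarrow> vf a f p = deriv_at f p (a p)"
  by (simp add: vf_def)

lemma vf_not_smooth: "\<not> smooth_on UNIV f \<Longrightarrow> vf a f = 0"
  by (simp add: vf_def)

lemma vf_eqI:
  assumes "\<And>f. \<not> smooth_on UNIV f \<Longrightarrow> X f = 0"
    and "\<And>f p. smooth_on UNIV f \<Longrightarrow> X f p = deriv_at f p (a p)"
  shows "X = vf a"
  by (rule ext, rule ext) (metis assms vf_smooth vf_not_smooth)

lemma deriv_at_linear: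
  assumes "smooth_on UNIV f"
  shows "deriv_at f p (v + w) = deriv_at f p v + deriv_at f p w"
    "deriv_at f p (v - w) = deriv_at f p v - deriv_at f p w"
    "deriv_at f p (s *\<^sub>R v) = s *\<^sub>R deriv_at f p v"
    "deriv_at f p 0 = 0"
proof -
  interpret bounded_linear "deriv_at f p" by (rule smooth_bounded_linear_deriv[OF assms])
  show "deriv_at f p (v + w) = deriv_at f p v + deriv_at f p w"
    "deriv_at f p (v - w) = deriv_at f p v - deriv_at f p w"
    "deriv_at f p (s *\<^sub>R v) = s *\<^sub>R deriv_at f p v"
    "deriv_at f p 0 = 0"
    by (simp_all add: add diff scaleR zero)
qed

lemma vf_add: "vf a + vf b = vf (\<lambda>p. a p + b p)"
  by (rule vf_eqI) (simp_all add: vf_def deriv_at_linear)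

lemma vf_diff: "vf a - vf b = vf (\<lambda>p. a p - b p)"
  by (rule vf_eqI) (simp_all add: vf_def deriv_at_linear)

lemma vf_scale: "h \<bullet>\<^sub>f vf a = vf (\<lambda>p. h p *\<^sub>R a p)"
  by (rule vf_eqI) (simp_all add: vf_def fscale_def deriv_at_linear)

lemma vf_0: "vf (\<lambda>p. 0) = 0"
  by (rule vf_eqI[symmetric]) (simp_all add: deriv_at_linear)

lemma vf_sum: "(\<Sum>i\<in>I. h i \<bullet>\<^sub>f vf (a i)) = vf (\<lambda>p. \<Sum>i\<in>I. h i p *\<^sub>R a i p)"
  by (induction I rule: infinite_finite_induct) (simp_all add: vf_0 vf_add vf_scale)

lemma deriv_at_bounded_linear: "bounded_linear f \<Longrightarrow> deriv_at f p = f"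
  by (rule deriv_at_eq) (rule bounded_linear_imp_has_derivative)

lemma vf_inject: "vf a = vf b \<longleftrightarrow> a = b"
proof
  assume eq: "vf a = vf b"
  \<comment> \<open>Linear functions suffice to recover the coefficients.\<close>
  have "a p \<bullet> i = b p \<bullet> i" for p i
  proof -
    have "bounded_linear (\<lambda>q. q \<bullet> i)" by (rule bounded_linear_inner_left)
    then show ?thesis
      using vf_smooth[of "\<lambda>q. q \<bullet> i" a p] vf_smooth[of "\<lambda>q. q \<bullet> i" b p] eq
      by (simp add: smooth_on_bounded_linear deriv_at_bounded_linear)
  qed
  then show "a = b" by (metis ext vector_eq_rdot)
qed simp

lemma directional_deriv_has_derivative:
  fixes f :: "'a::euclidean_space \<Rightarrow> 'b::real_normed_vector"
  assumes "smooth_on UNIV f" "smooth_on UNIV b"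
  shows "((\<lambda>q. deriv_at f q (b q)) has_derivative
    (\<lambda>w. deriv_at f p (deriv_at b p w) + deriv_at (\<lambda>q. deriv_at f q (b p)) p w)) (at p)"
proof -
  have D: "deriv_at f q v = (\<Sum>i\<in>Basis. (v \<bullet> i) *\<^sub>R deriv_at f q i)" for q v
    by (rule deriv_at_euclidean_representation[OF smooth_onD[OF assms(1)]])
  have d: "((\<lambda>q. \<Sum>i\<in>Basis. (c q \<bullet> i) *\<^sub>R deriv_at f q i) has_derivative
      (\<lambda>w. \<Sum>i\<in>Basis. (c p \<bullet> i) *\<^sub>R deriv_at (\<lambda>q. deriv_at f q i) p w
        + (deriv_at c p w \<bullet> i) *\<^sub>R deriv_at f p i)) (at p)" if c: "smooth_on UNIV c" for c
    by (intro has_derivative_sum has_derivative_scaleR smooth_has_derivative[OF smooth_on_deriv_at[OF assms(1)]]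
        has_derivative_inner_left smooth_has_derivative[OF c])
  have "deriv_at (\<lambda>q. deriv_at f q (b p)) p w
      = (\<Sum>i\<in>Basis. (b p \<bullet> i) *\<^sub>R deriv_at (\<lambda>q. deriv_at f q i) p w)" for w
    using deriv_at_eq[OF d[OF smooth_on_const[of "b p"]]]
    by (simp add: D[symmetric])
  with d[OF assms(2)] show ?thesis
    by (simp add: D[symmetric] sum.distrib add.commute)
qed

text \<open>The second-order parts of the two compositions are mixed derivatives of f in the
  directions \<open>a p\<close> and \<open>b p\<close>. They cancel by symmetry, and only the
  derivatives of the coefficients remain.\<close>

lemma bracket_vf:
  assumes a: "smooth_on UNIV a" and b: "smooth_on UNIV b"
  shows "bracket (vf a) (vf b) = vf (\<lambda>p. deriv_at b p (a p) - deriv_at a p (b p))"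
proof (rule vf_eqI)
  fix f :: "'a \<Rightarrow> real" and p
  assume f: "smooth_on UNIV f"
  have vf: "vf c f = (\<lambda>q. deriv_at f q (c q))" for c using f by (simp add: vf_def)
  have d: "vf c (vf c' f) p = deriv_at f p (deriv_at c' p (c p)) + deriv_at (\<lambda>q. deriv_at f q (c' p)) p (c p)"
    if "smooth_on UNIV c'" for c c'
    using vf_smooth[OF smooth_on_directional_deriv[OF f that]]
      deriv_at_eq[OF directional_deriv_has_derivative[OF f that]] by (simp add: vf)
  show "bracket (vf a) (vf b) f p = deriv_at f p (deriv_at b p (a p) - deriv_at a p (b p))"
    using symmetric_second_derivative[OF smooth_onD[OF f], of "b p" p "a p"]
    by (simp add: bracket_def d a b deriv_at_linear[OF f])
qed (auto simp: bracket_def vf_def smooth_on_const zero_fun_def)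

section \<open>Global frames\<close>

lemma linear_expansion:
  fixes f :: "real^'n \<Rightarrow> 'a::real_vector"
  assumes "linear f"
  shows "f x = (\<Sum>i\<in>UNIV. x $ i *\<^sub>R f (axis i 1))"
proof -
  have "f x = f (\<Sum>i\<in>UNIV. x $ i *\<^sub>R axis i 1)"
    by (rule arg_cong[where f = f]) (simp add: vec_eq_iff axis_def if_distrib cong: if_cong)
  then show ?thesis by (simp add: linear_sum[OF assms] linear_scale[OF assms])
qed
text \<open>The frame is encoded by the isomorphisms \<open>\<Phi> p\<close> from coefficient vectors to tangent vectors, with
  inverse \<open>\<Theta> p\<close>; \<open>c\<close> collects the structure constants.\<close>

locale global_frame =
  fixes \<Phi> \<Theta> c :: "real^5 \<Rightarrow> real^5 \<Rightarrow> real^5"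
  assumes linear_\<Phi>: "linear (\<Phi> p)"
    and \<Theta>_\<Phi>: "\<Theta> p (\<Phi> p x) = x"
    and \<Phi>_\<Theta>: "\<Phi> p (\<Theta> p v) = v"
    and smooth_\<Phi>_const: "smooth_on UNIV (\<lambda>p. \<Phi> p x)"
    and smooth_\<Theta>_const: "smooth_on UNIV (\<lambda>p. \<Theta> p v)"
    and structure_equation:
      "deriv_at (\<lambda>q. \<Phi> q y) p (\<Phi> p x) - deriv_at (\<lambda>q. \<Phi> q x) p (\<Phi> p y) = \<Phi> p (c x y)"
begin

lemma \<Phi>_linear: "\<Phi> p (x + y) = \<Phi> p x + \<Phi> p y" "\<Phi> p (x - y) = \<Phi> p x - \<Phi> p y"
    "\<Phi> p (s *\<^sub>R x) = s *\<^sub>R \<Phi> p x" "\<Phi> p (\<Sum>i\<in>I. f i) = (\<Sum>i\<in>I. \<Phi> p (f i))"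
  by (simp_all add: linear_add linear_diff linear_scale linear_sum linear_\<Phi>)

lemma linear_\<Theta>: "linear (\<Theta> p)"
proof (rule linearI)
  show "\<Theta> p (v + w) = \<Theta> p v + \<Theta> p w" for v w
    using \<Theta>_\<Phi>[of p "\<Theta> p v + \<Theta> p w"] by (simp add: \<Phi>_linear \<Phi>_\<Theta>)
  show "\<Theta> p (s *\<^sub>R v) = s *\<^sub>R \<Theta> p v" for s v
    using \<Theta>_\<Phi>[of p "s *\<^sub>R \<Theta> p v"] by (simp add: \<Phi>_linear \<Phi>_\<Theta>)
qed

lemma smooth_\<Phi>: "smooth_on UNIV x \<Longrightarrow> smooth_on UNIV (\<lambda>p. \<Phi> p (x p))"
  by (subst linear_expansion[OF linear_\<Phi>])
    (intro smooth_on_sum smooth_on_bilinear[OF bounded_bilinear_scaleR] smooth_on_vec_nth smooth_\<Phi>_const)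

lemma smooth_\<Theta>: "smooth_on UNIV v \<Longrightarrow> smooth_on UNIV (\<lambda>p. \<Theta> p (v p))"
  by (subst linear_expansion[OF linear_\<Theta>])
    (intro smooth_on_sum smooth_on_bilinear[OF bounded_bilinear_scaleR] smooth_on_vec_nth smooth_\<Theta>_const)

text \<open>The coefficients may depend on the point, so every field has this form; the
  left-invariant ones turn out to be those with constant coefficients.\<close>

definition fr :: "(real^5 \<Rightarrow> real^5) \<Rightarrow> (real^5) vfield" where
  "fr x = vf (\<lambda>p. \<Phi> p (x p))"

definition frame :: "5 \<Rightarrow> (real^5) vfield" where
  "frame i = fr (\<lambda>p. axis i 1)"

lemma vector_fields_fr: "vector_fields std_atlas = {fr x |x. smooth_on UNIV x}"
proof (intro equalityI subsetI)
  fix X :: "(real^5) vfield" assume "X \<in> vector_fields std_atlas"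
  then obtain a where "smooth_on UNIV a" "X = vf a" by (auto simp: vector_fields_std)
  then have "X = fr (\<lambda>p. \<Theta> p (a p))" "smooth_on UNIV (\<lambda>p. \<Theta> p (a p))"
    by (simp_all add: fr_def \<Phi>_\<Theta> smooth_\<Theta>)
  then show "X \<in> {fr x |x. smooth_on UNIV x}" by auto
next
  fix X assume "X \<in> {fr x |x. smooth_on UNIV x}"
  then obtain x where "smooth_on UNIV x" "X = fr x" by auto
  then show "X \<in> vector_fields std_atlas" using smooth_\<Phi> by (auto simp: vector_fields_std fr_def)
qed

lemma fr_in_vector_fields: "smooth_on UNIV x \<Longrightarrow> fr x \<in> vector_fields std_atlas"
  using vector_fields_fr by blast

lemma fr_inject: "fr x = fr y \<longleftrightarrow> x = y"
  unfolding fr_def vf_inject by (metis (no_types, lifting) \<Theta>_\<Phi> ext)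

lemma fr_add: "fr x + fr y = fr (\<lambda>p. x p + y p)"
  by (simp add: fr_def vf_add \<Phi>_linear)

lemma fr_diff: "fr x - fr y = fr (\<lambda>p. x p - y p)"
  by (simp add: fr_def vf_diff \<Phi>_linear)

lemma fr_scale: "h \<bullet>\<^sub>f fr x = fr (\<lambda>p. h p *\<^sub>R x p)"
  by (simp add: fr_def vf_scale \<Phi>_linear)

lemma fr_0: "fr (\<lambda>p. 0) = 0"
  by (simp add: fr_def vf_0 linear_0[OF linear_\<Phi>])

lemma fr_smooth: "smooth_on UNIV h \<Longrightarrow> fr x h p = deriv_at h p (\<Phi> p (x p))"
  by (simp add: fr_def vf_smooth)

lemma sum_frame: "(\<Sum>i\<in>I. (\<lambda>p. x p $ i) \<bullet>\<^sub>f frame i) = fr (\<lambda>p. \<chi> i. if i \<in> I then x p $ i else 0)"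
proof -
  have "(\<Sum>i\<in>I. x p $ i *\<^sub>R axis i 1) = (\<chi> i. if i \<in> I then x p $ i else 0)" for p
    by (simp add: vec_eq_iff axis_def if_distrib cong: if_cong)
  then show ?thesis
    by (simp add: frame_def fr_def vf_sum \<Phi>_linear[symmetric])
qed

lemma sum_frame_UNIV: "(\<Sum>i\<in>UNIV. (\<lambda>p. x p $ i) \<bullet>\<^sub>f frame i) = fr x"
  by (simp add: sum_frame)

lemma coframe_fr: "coframe frame (fr x) = x"
  unfolding coframe_def sum_frame_UNIV fr_inject by simp

lemma deriv_at_\<Phi>:
  assumes "smooth_on UNIV x"
  shows "deriv_at (\<lambda>q. \<Phi> q (x q)) p w = deriv_at (\<lambda>q. \<Phi> q (x p)) p w + \<Phi> p (deriv_at x p w)"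
proof -
  note E = linear_expansion[OF linear_\<Phi>]
  have d: "((\<lambda>q. \<Phi> q (y q)) has_derivative (\<lambda>w. \<Sum>i\<in>UNIV. y p $ i *\<^sub>R deriv_at (\<lambda>q. \<Phi> q (axis i 1)) p w
      + deriv_at y p w $ i *\<^sub>R \<Phi> p (axis i 1))) (at p)" if "smooth_on UNIV y" for y
    by (subst E) (intro has_derivative_sum has_derivative_scaleR smooth_has_derivative smooth_\<Phi>_const
        bounded_linear.has_derivative[OF bounded_linear_vec_nth] that)
  show ?thesis
    unfolding deriv_at_eq[OF d[OF assms]] deriv_at_eq[OF d[OF smooth_on_const[of "x p"]]] E[of p "deriv_at x p w"]
    by (simp add: sum.distrib)
qed

text \<open>The product rule yields the derivative terms; freezing both coefficient vectors at p
  leaves the situation of \<open>structure_equation\<close>.\<close>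

lemma bracket_fr:
  assumes "smooth_on UNIV x" "smooth_on UNIV y"
  shows "bracket (fr x) (fr y)
    = fr (\<lambda>p. deriv_at y p (\<Phi> p (x p)) - deriv_at x p (\<Phi> p (y p)) + c (x p) (y p))"
proof -
  have "deriv_at (\<lambda>q. \<Phi> q (y q)) p (\<Phi> p (x p)) - deriv_at (\<lambda>q. \<Phi> q (x q)) p (\<Phi> p (y p))
      = \<Phi> p (deriv_at y p (\<Phi> p (x p)) - deriv_at x p (\<Phi> p (y p)) + c (x p) (y p))" for p
    using structure_equation[of "y p" p "x p"] by (simp add: deriv_at_\<Phi> assms \<Phi>_linear algebra_simps)
  then show ?thesis by (simp add: fr_def bracket_vf smooth_\<Phi> assms)
qed

lemma bracket_fr_const: "bracket (fr (\<lambda>p. x)) (fr (\<lambda>p. y)) = fr (\<lambda>p. c x y)"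
  using bracket_fr[OF smooth_on_const smooth_on_const, of x y] by simp

lemma metric_fr: "metric frame (fr x) (fr y) = (\<lambda>p. x p \<bullet> y p)"
  by (simp add: metric_def coframe_fr inner_vec_def)

lemma so3_tensor_fr: "so3_tensor frame (fr x) (fr y) (fr z) = (\<lambda>p. polar (x p) (y p) (z p))"
  by (simp add: so3_tensor_def coframe_fr)

lemma frame_span_eq: "frame_span frame I = {fr (\<lambda>p. x) |x. \<forall>i. i \<notin> I \<longrightarrow> x $ i = 0}"
proof (intro equalityI subsetI)
  fix X assume "X \<in> frame_span frame I"
  then obtain a :: "5 \<Rightarrow> real" where "X = (\<Sum>i\<in>I. (\<lambda>p. a i) \<bullet>\<^sub>f frame i)"
    by (auto simp: frame_span_def)
  with sum_frame[of "\<lambda>p. vec_lambda a" I]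
  show "X \<in> {fr (\<lambda>p. x) |x. \<forall>i. i \<notin> I \<longrightarrow> x $ i = 0}" by auto
next
  fix X assume "X \<in> {fr (\<lambda>p. x) |x. \<forall>i. i \<notin> I \<longrightarrow> x $ i = 0}"
  then obtain x where X: "X = fr (\<lambda>p. x)" and x: "\<forall>i. i \<notin> I \<longrightarrow> x $ i = 0" by blast
  from x have "(\<chi> i. if i \<in> I then x $ i else 0) = x" by (auto simp: vec_eq_iff)
  with sum_frame[of "\<lambda>p. x" I] have "X = (\<Sum>i\<in>I. (\<lambda>p. x $ i) \<bullet>\<^sub>f frame i)" using X by simp
  then show "X \<in> frame_span frame I" unfolding frame_span_def by (auto intro!: exI[of _ "\<lambda>i. x $ i"])
qed

subsection \<open>Connections with constant coefficients\<close>

text \<open>The flat connection with parallel frame, plus the tensor \<Gamma>. Metric and cubic have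
  constant coefficients in the frame, so the flat part preserves both and only \<Gamma> has to be
  tested.\<close>

definition conn :: "(real^5 \<Rightarrow> real^5 \<Rightarrow> real^5) \<Rightarrow> (real^5) conn" where
  "conn \<Gamma> X Y = fr (\<lambda>p. deriv_at (coframe frame Y) p (\<Phi> p (coframe frame X p))
     + \<Gamma> (coframe frame X p) (coframe frame Y p))"

lemma conn_fr: "conn \<Gamma> (fr x) (fr y) = fr (\<lambda>p. deriv_at y p (\<Phi> p (x p)) + \<Gamma> (x p) (y p))"
  by (simp add: conn_def coframe_fr)

lemma smooth_conn:
  assumes "bounded_bilinear \<Gamma>" "smooth_on UNIV x" "smooth_on UNIV y"
  shows "smooth_on UNIV (\<lambda>p. deriv_at y p (\<Phi> p (x p)) + \<Gamma> (x p) (y p))"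
  by (intro smooth_on_add smooth_on_directional_deriv smooth_\<Phi> smooth_on_bilinear[OF assms(1)] assms)

lemma affine_connection_conn:
  assumes \<Gamma>: "bounded_bilinear \<Gamma>"
  shows "affine_connection std_atlas (conn \<Gamma>)"
proof -
  interpret \<Gamma>: bounded_bilinear \<Gamma> by (rule \<Gamma>)
  have add: "deriv_at (\<lambda>p. y p + z p) p v = deriv_at y p v + deriv_at z p v"
    if "smooth_on UNIV y" "smooth_on UNIV z" for y z :: "real^5 \<Rightarrow> real^5" and p v
    using deriv_at_eq[OF has_derivative_add[OF that[THEN smooth_has_derivative]]] by simp
  have scale: "deriv_at (\<lambda>p. h p *\<^sub>R y p) p v = h p *\<^sub>R deriv_at y p v + deriv_at h p v *\<^sub>R y p"
    if "smooth_on UNIV h" "smooth_on UNIV y" for h and y :: "real^5 \<Rightarrow> real^5" and p v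
    using deriv_at_eq[OF has_derivative_scaleR[OF that[THEN smooth_has_derivative]]] by simp
  show ?thesis
    unfolding affine_connection_def vector_fields_fr smooth_functions_std
  proof (intro conjI ballI; clarify)
    fix x y :: "real^5 \<Rightarrow> real^5" assume xy: "smooth_on UNIV x" "smooth_on UNIV y"
    show "\<exists>z. conn \<Gamma> (fr x) (fr y) = fr z \<and> smooth_on UNIV z"
      using smooth_conn[OF \<Gamma> xy] conn_fr by blast
    fix z :: "real^5 \<Rightarrow> real^5" assume z: "smooth_on UNIV z"
    show "conn \<Gamma> (fr x + fr y) (fr z) = conn \<Gamma> (fr x) (fr z) + conn \<Gamma> (fr y) (fr z)"
      by (simp add: conn_fr fr_add \<Phi>_linear deriv_at_linear[OF z] \<Gamma>.add_left add.commute add.left_commute)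
    show "conn \<Gamma> (fr x) (fr y + fr z) = conn \<Gamma> (fr x) (fr y) + conn \<Gamma> (fr x) (fr z)"
      by (simp add: conn_fr fr_add add xy z \<Gamma>.add_right add.commute add.left_commute)
  next
    fix h :: "real^5 \<Rightarrow> real" and x y :: "real^5 \<Rightarrow> real^5"
    assume h: "smooth_on UNIV h" and xy: "smooth_on UNIV x" "smooth_on UNIV y"
    show "conn \<Gamma> (h \<bullet>\<^sub>f fr x) (fr y) = h \<bullet>\<^sub>f conn \<Gamma> (fr x) (fr y)"
      by (simp add: conn_fr fr_scale \<Phi>_linear deriv_at_linear[OF xy(2)] \<Gamma>.scaleR_left scaleR_add_right)
    have "fr x h = (\<lambda>p. deriv_at h p (\<Phi> p (x p)))" using fr_smooth[OF h] by blast
    then show "conn \<Gamma> (fr x) (h \<bullet>\<^sub>f fr y) = fr x h \<bullet>\<^sub>f fr y + h \<bullet>\<^sub>f conn \<Gamma> (fr x) (fr y)"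
      by (simp add: conn_fr fr_scale fr_add scale h xy \<Gamma>.scaleR_right scaleR_add_right
          add.commute add.left_commute)
  qed
qed

lemma metric_connection_conn:
  assumes \<Gamma>: "bounded_bilinear \<Gamma>" and skew: "\<And>x y z. \<Gamma> x y \<bullet> z + y \<bullet> \<Gamma> x z = 0"
  shows "metric_connection std_atlas frame (conn \<Gamma>)"
  unfolding metric_connection_def vector_fields_fr
proof (intro conjI ballI affine_connection_conn[OF \<Gamma>]; clarify)
  fix x y z :: "real^5 \<Rightarrow> real^5" assume xyz: "smooth_on UNIV x" "smooth_on UNIV y" "smooth_on UNIV z"
  have "deriv_at (\<lambda>p. y p \<bullet> z p) p v = y p \<bullet> deriv_at z p v + deriv_at y p v \<bullet> z p" for p v
    using deriv_at_eq[OF has_derivative_inner[OF xyz(2,3)[THEN smooth_has_derivative]]] by simp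
  moreover have "smooth_on UNIV (\<lambda>p. y p \<bullet> z p)"
    by (intro smooth_on_bilinear[OF bounded_bilinear_inner] xyz)
  ultimately show "fr x (metric frame (fr y) (fr z))
      = metric frame (conn \<Gamma> (fr x) (fr y)) (fr z) + metric frame (fr y) (conn \<Gamma> (fr x) (fr z))"
    using skew[of "x _" "y _" "z _"]
    by (auto simp: fun_eq_iff conn_fr metric_fr fr_smooth inner_add_left inner_add_right algebra_simps)
qed

lemma torsion_conn:
  assumes "smooth_on UNIV x" "smooth_on UNIV y"
  shows "torsion (conn \<Gamma>) (fr x) (fr y) = fr (\<lambda>p. \<Gamma> (x p) (y p) - \<Gamma> (y p) (x p) - c (x p) (y p))"
  by (simp add: torsion_def conn_fr bracket_fr[OF assms] fr_diff algebra_simps)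

lemma torsion_form_conn:
  assumes "smooth_on UNIV x" "smooth_on UNIV y"
  shows "torsion_form frame (conn \<Gamma>) (fr x) (fr y) (fr z)
    = (\<lambda>p. (\<Gamma> (x p) (y p) - \<Gamma> (y p) (x p) - c (x p) (y p)) \<bullet> z p)"
  by (simp add: torsion_form_def torsion_conn[OF assms] metric_fr)

lemma levi_civita_conn:
  assumes "bounded_bilinear \<Gamma>" and "\<And>x y z. \<Gamma> x y \<bullet> z + y \<bullet> \<Gamma> x z = 0"
    and "\<And>x y. \<Gamma> x y - \<Gamma> y x = c x y"
  shows "levi_civita std_atlas frame (conn \<Gamma>)"
  unfolding levi_civita_def vector_fields_fr
  by (auto simp: metric_connection_conn assms torsion_conn fr_0)

lemma cov_deriv_so3_tensor:
  assumes "smooth_on UNIV w" "smooth_on UNIV x" "smooth_on UNIV y" "smooth_on UNIV z"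
  shows "cov_deriv (conn \<Gamma>) (so3_tensor frame) (fr w) (fr x) (fr y) (fr z)
    = (\<lambda>p. - polar (\<Gamma> (w p) (x p)) (y p) (z p) - polar (x p) (\<Gamma> (w p) (y p)) (z p)
        - polar (x p) (y p) (\<Gamma> (w p) (z p)))"
proof -
  have "deriv_at (\<lambda>p. polar (x p) (y p) (z p)) p v = polar (deriv_at x p v) (y p) (z p)
      + polar (x p) (deriv_at y p v) (z p) + polar (x p) (y p) (deriv_at z p v)" for p v
    using deriv_at_eq[OF polar_has_derivative[OF assms(2-4)[THEN smooth_has_derivative]]] by simp
  then show ?thesis
    by (simp add: fun_eq_iff cov_deriv_def so3_tensor_fr conn_fr fr_smooth[OF smooth_on_polar[OF assms(2-4)]]
        polar_add)
qed

lemma nearly_integrable_conn: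
  assumes "levi_civita std_atlas frame (conn \<Gamma>)" and "\<And>x. polar (\<Gamma> x x) x x = 0"
  shows "nearly_integrable std_atlas frame"
proof -
  have "polar x (\<Gamma> x x) x = 0" "polar x x (\<Gamma> x x) = 0" for x
    using assms(2)[of x] by (metis polar_commute)+
  then have "cov_deriv (conn \<Gamma>) (so3_tensor frame) X X X X = 0" if "X \<in> vector_fields std_atlas" for X
    using that by (auto simp: vector_fields_fr cov_deriv_so3_tensor assms(2) zero_fun_def)
  then show ?thesis unfolding nearly_integrable_def using assms(1) by blast
qed

lemma characteristic_connection_conn:
  assumes "bounded_bilinear \<Gamma>" and "\<And>x y z. \<Gamma> x y \<bullet> z + y \<bullet> \<Gamma> x z = 0"
    and so3: "\<And>w x y z. polar (\<Gamma> w x) y z + polar x (\<Gamma> w y) z + polar x y (\<Gamma> w z) = 0"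
    and skew: "\<And>x y z. (\<Gamma> x z - \<Gamma> z x - c x z) \<bullet> y = - ((\<Gamma> x y - \<Gamma> y x - c x y) \<bullet> z)"
      "\<And>x y z. (\<Gamma> y x - \<Gamma> x y - c y x) \<bullet> z = - ((\<Gamma> x y - \<Gamma> y x - c x y) \<bullet> z)"
  shows "characteristic_connection std_atlas frame (conn \<Gamma>)"
proof -
  have so3': "- polar (\<Gamma> w x) y z - polar x (\<Gamma> w y) z - polar x y (\<Gamma> w z) = 0" for w x y z
    using so3[of w x y z] by linarith
  show ?thesis
    unfolding characteristic_connection_def vector_fields_fr
  proof (intro conjI ballI metric_connection_conn assms(1,2); clarify)
    fix x y z :: "real^5 \<Rightarrow> real^5" assume xyz: "smooth_on UNIV x" "smooth_on UNIV y" "smooth_on UNIV z"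
    show "torsion_form frame (conn \<Gamma>) (fr y) (fr x) (fr z) = - torsion_form frame (conn \<Gamma>) (fr x) (fr y) (fr z)"
      unfolding torsion_form_conn[OF xyz(1,2)] torsion_form_conn[OF xyz(2,1)] fun_eq_iff fun_Compl_def
      using skew(2) by blast
    show "torsion_form frame (conn \<Gamma>) (fr x) (fr z) (fr y) = - torsion_form frame (conn \<Gamma>) (fr x) (fr y) (fr z)"
      unfolding torsion_form_conn[OF xyz(1,2)] torsion_form_conn[OF xyz(1,3)] fun_eq_iff fun_Compl_def
      using skew(1) by blast
    fix w :: "real^5 \<Rightarrow> real^5" assume "smooth_on UNIV w"
    then show "cov_deriv (conn \<Gamma>) (so3_tensor frame) (fr w) (fr x) (fr y) (fr z) = 0"
      by (simp add: cov_deriv_so3_tensor xyz so3' zero_fun_def)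
  qed
qed

end

section \<open>Sums and differences of two-forms\<close>

lemma two_forms_add:
  fixes \<alpha> \<beta> :: "'a::euclidean_space form2"
  assumes \<alpha>: "\<alpha> \<in> two_forms std_atlas" and \<beta>: "\<beta> \<in> two_forms std_atlas"
  shows "\<alpha> + \<beta> \<in> two_forms std_atlas"
  unfolding two_forms_def smooth_functions_std mem_Collect_eq
proof (intro conjI ballI)
  note form = two_forms_def smooth_functions_std mem_Collect_eq
  fix X Y :: "'a vfield" assume XY: "X \<in> vector_fields std_atlas" "Y \<in> vector_fields std_atlas"
  have "smooth_on UNIV (\<alpha> X Y)" "smooth_on UNIV (\<beta> X Y)" using \<alpha> \<beta> XY unfolding form by blast+
  from smooth_on_add[OF this] show "smooth_on UNIV ((\<alpha> + \<beta>) X Y)" by (simp add: plus_fun_def)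
  have "\<alpha> Y X = - \<alpha> X Y" "\<beta> Y X = - \<beta> X Y" using \<alpha> \<beta> XY unfolding form by blast+
  then show "(\<alpha> + \<beta>) Y X = - (\<alpha> + \<beta>) X Y" by (simp add: fun_eq_iff)
  have "\<alpha> (X + Y) Z = \<alpha> X Z + \<alpha> Y Z" "\<beta> (X + Y) Z = \<beta> X Z + \<beta> Y Z"
    if "Z \<in> vector_fields std_atlas" for Z using \<alpha> \<beta> XY that unfolding form by blast+
  then show "(\<alpha> + \<beta>) (X + Y) Z = (\<alpha> + \<beta>) X Z + (\<alpha> + \<beta>) Y Z"
    if "Z \<in> vector_fields std_atlas" for Z using that by (simp add: fun_eq_iff)
  have "\<alpha> (h \<bullet>\<^sub>f X) Y = h * \<alpha> X Y" "\<beta> (h \<bullet>\<^sub>f X) Y = h * \<beta> X Y"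
    if "h \<in> {f. smooth_on UNIV f}" for h using \<alpha> \<beta> XY that unfolding form by blast+
  then show "(\<alpha> + \<beta>) (h \<bullet>\<^sub>f X) Y = h * (\<alpha> + \<beta>) X Y"
    if "h \<in> {f. smooth_on UNIV f}" for h using that by (simp add: fun_eq_iff algebra_simps)
qed

lemma two_forms_diff:
  fixes \<alpha> \<beta> :: "'a::euclidean_space form2"
  assumes \<alpha>: "\<alpha> \<in> two_forms std_atlas" and \<beta>: "\<beta> \<in> two_forms std_atlas"
  shows "\<alpha> - \<beta> \<in> two_forms std_atlas"
  unfolding two_forms_def smooth_functions_std mem_Collect_eq
proof (intro conjI ballI)
  note form = two_forms_def smooth_functions_std mem_Collect_eq
  fix X Y :: "'a vfield" assume XY: "X \<in> vector_fields std_atlas" "Y \<in> vector_fields std_atlas"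
  have "smooth_on UNIV (\<alpha> X Y)" "smooth_on UNIV (\<beta> X Y)" using \<alpha> \<beta> XY unfolding form by blast+
  from smooth_on_diff[OF this] show "smooth_on UNIV ((\<alpha> - \<beta>) X Y)" by (simp add: fun_diff_def)
  have "\<alpha> Y X = - \<alpha> X Y" "\<beta> Y X = - \<beta> X Y" using \<alpha> \<beta> XY unfolding form by blast+
  then show "(\<alpha> - \<beta>) Y X = - (\<alpha> - \<beta>) X Y" by (simp add: fun_eq_iff)
  have "\<alpha> (X + Y) Z = \<alpha> X Z + \<alpha> Y Z" "\<beta> (X + Y) Z = \<beta> X Z + \<beta> Y Z"
    if "Z \<in> vector_fields std_atlas" for Z using \<alpha> \<beta> XY that unfolding form by blast+
  then show "(\<alpha> - \<beta>) (X + Y) Z = (\<alpha> - \<beta>) X Z + (\<alpha> - \<beta>) Y Z"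
    if "Z \<in> vector_fields std_atlas" for Z using that by (simp add: fun_eq_iff)
  have "\<alpha> (h \<bullet>\<^sub>f X) Y = h * \<alpha> X Y" "\<beta> (h \<bullet>\<^sub>f X) Y = h * \<beta> X Y"
    if "h \<in> {f. smooth_on UNIV f}" for h using \<alpha> \<beta> XY that unfolding form by blast+
  then show "(\<alpha> - \<beta>) (h \<bullet>\<^sub>f X) Y = h * (\<alpha> - \<beta>) X Y"
    if "h \<in> {f. smooth_on UNIV f}" for h using that by (simp add: fun_eq_iff algebra_simps)
qed

context global_frame
begin

subsection \<open>The torsion form\<close>

lemma wedge2_fr: "wedge2 frame i j (fr x) (fr y) = (\<lambda>p. x p $ i * y p $ j - x p $ j * y p $ i)"
  by (simp add: wedge2_def coframe_fr)

lemma wedge2_in_two_forms: "(\<lambda>p. s) \<bullet>\<^sub>2 wedge2 frame i j \<in> two_forms std_atlas"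
  unfolding two_forms_def vector_fields_fr smooth_functions_std mem_Collect_eq
proof (intro conjI ballI; clarify)
  fix x y :: "real^5 \<Rightarrow> real^5" assume xy: "smooth_on UNIV x" "smooth_on UNIV y"
  show "smooth_on UNIV (((\<lambda>p. s) \<bullet>\<^sub>2 wedge2 frame i j) (fr x) (fr y))"
    unfolding form_scale_def wedge2_fr times_fun_def
    by (intro smooth_on_mult smooth_on_diff smooth_on_vec_nth smooth_on_const xy)
qed (simp_all add: form_scale_def fr_add fr_scale wedge2_fr fun_eq_iff algebra_simps)

text \<open>Orthogonality to \<open>Lambda2_3\<close> is pointwise and linear in the coefficient
  functions, so it reduces to three numerical equations, one for each of E1, E2, E3.\<close>

lemma type_Lambda2_7_const:
  assumes T: "\<And>i j k. T (frame i) (frame j) (frame k) = (\<lambda>p. t i j k)"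
    and "sqrt 3 * t 2 3 4 = t 1 4 5 + t 1 2 3" "sqrt 3 * t 2 4 5 = t 1 3 4 + t 1 2 5"
      "2 * t 1 3 5 + t 1 2 4 = 0"
    and "t i j k \<noteq> 0"
  shows "type_Lambda2_7 std_atlas frame T"
proof -
  have "hodge_star3 frame T \<in> two_forms std_atlas"
    unfolding hodge_star3_def T by (intro two_forms_add two_forms_diff wedge2_in_two_forms)
  moreover have "form_inner frame (hodge_star3 frame T) (a \<bullet>\<^sub>2 E1 frame + b \<bullet>\<^sub>2 E2 frame + d \<bullet>\<^sub>2 E3 frame) = 0" for a b d
  proof
    fix p
    have w: "wedge2 frame i j (frame k) (frame l) p
        = axis k 1 $ i * axis l 1 $ j - axis k 1 $ j * axis l 1 $ i" for i j k l
      unfolding frame_def wedge2_fr by (rule refl)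
    have "form_inner frame (hodge_star3 frame T) (a \<bullet>\<^sub>2 E1 frame + b \<bullet>\<^sub>2 E2 frame + d \<bullet>\<^sub>2 E3 frame) p
      = a p * (t 1 4 5 + t 1 2 3 - sqrt 3 * t 2 3 4) + b p * (t 1 3 4 + t 1 2 5 - sqrt 3 * t 2 4 5)
        - d p * (2 * t 1 3 5 + t 1 2 4)"
      unfolding form_inner_def hodge_star3_def E1_def E2_def E3_def T
      by (simp add: form_scale_def w sum_5 axis_def) (simp add: algebra_simps)
    then show "form_inner frame (hodge_star3 frame T) (a \<bullet>\<^sub>2 E1 frame + b \<bullet>\<^sub>2 E2 frame + d \<bullet>\<^sub>2 E3 frame) p
      = (0 :: _ \<Rightarrow> real) p"
      using assms(2-4) by simp
  qed
  ultimately have "hodge_star3 frame T \<in> Lambda2_7 std_atlas frame"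
    by (auto simp: Lambda2_7_def Lambda2_3_def)
  moreover have "frame i \<in> vector_fields std_atlas" for i
    unfolding frame_def by (intro fr_in_vector_fields smooth_on_const)
  moreover have "T (frame i) (frame j) (frame k) \<noteq> 0"
    using T[of i j k] assms(5) by (auto simp: fun_eq_iff)
  ultimately show ?thesis unfolding type_Lambda2_7_def by blast
qed

text \<open>On fields with constant coefficients the terms of \<open>ext_deriv3\<close> that
  differentiate values of T vanish, and only the bracket terms remain.\<close>

lemma not_closed3_const:
  assumes T: "\<And>x y z. T (fr (\<lambda>p. x)) (fr (\<lambda>p. y)) (fr (\<lambda>p. z)) = (\<lambda>p. t x y z)"
    and "- t (c w x) y z + t (c w y) x z - t (c w z) x y - t (c x y) w z + t (c x z) w y - t (c y z) w x \<noteq> 0"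
  shows "\<not> closed3 std_atlas T"
proof
  assume "closed3 std_atlas T"
  moreover have in_vf: "fr (\<lambda>p. x) \<in> vector_fields std_atlas" for x
    by (intro fr_in_vector_fields smooth_on_const)
  ultimately have "ext_deriv3 T (fr (\<lambda>p. w)) (fr (\<lambda>p. x)) (fr (\<lambda>p. y)) (fr (\<lambda>p. z)) = 0"
    unfolding closed3_def by blast
  moreover have "fr v (\<lambda>p. s) = 0" for v s
    by (simp add: fun_eq_iff fr_smooth smooth_on_const)
  ultimately show False
    using assms(2) by (simp add: ext_deriv3_def bracket_fr_const T fun_eq_iff)
qed

subsection \<open>Left-invariance\<close>

lemma bracket_in_frame_span:
  assumes "\<And>x y i. (\<And>i. i \<notin> I \<Longrightarrow> x $ i = 0) \<Longrightarrow> (\<And>i. i \<notin> J \<Longrightarrow> y $ i = 0) \<Longrightarrow> i \<notin> K \<Longrightarrow> c x y $ i = 0"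
  shows "bracket_in (frame_span frame I) (frame_span frame J) (frame_span frame K)"
  unfolding bracket_in_def frame_span_eq
proof (intro ballI, clarify)
  fix x y :: "real^5" assume "\<forall>i. i \<notin> I \<longrightarrow> x $ i = 0" "\<forall>i. i \<notin> J \<longrightarrow> y $ i = 0"
  then show "\<exists>z. bracket (fr (\<lambda>p. x)) (fr (\<lambda>p. y)) = fr (\<lambda>p. z) \<and> (\<forall>i. i \<notin> K \<longrightarrow> z $ i = 0)"
    using assms bracket_fr_const by blast
qed

lemma frame_span_Int:
  assumes "I \<inter> J = {}"
  shows "frame_span frame I \<inter> frame_span frame J = {0}"
proof (intro equalityI subsetI)
  fix X assume "X \<in> frame_span frame I \<inter> frame_span frame J"
  then obtain x y where X: "X = fr (\<lambda>p. x)" "X = fr (\<lambda>p. y)"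
    and x: "\<forall>i. i \<notin> I \<longrightarrow> x $ i = 0" and y: "\<forall>i. i \<notin> J \<longrightarrow> y $ i = 0"
    unfolding frame_span_eq by blast
  from X have "(\<lambda>p. x) = (\<lambda>p::real^5. y)" unfolding fr_inject[symmetric] by (rule trans[OF sym])
  then have "x = y" by (rule fun_cong)
  then have "x = 0" using x y assms by (auto simp: vec_eq_iff)
  then show "X \<in> {0}" by (simp add: X fr_0)
next
  fix X :: "(real^5) vfield" assume "X \<in> {0}"
  then have "X = fr (\<lambda>p. 0)" by (simp add: fr_0)
  then show "X \<in> frame_span frame I \<inter> frame_span frame J" unfolding frame_span_eq by force
qed

lemma frame_span_add:
  assumes "I \<union> J = UNIV"
  shows "{X + Y |X Y. X \<in> frame_span frame I \<and> Y \<in> frame_span frame J} = {fr (\<lambda>p. x) |x. True}"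
proof (intro equalityI subsetI)
  fix Z assume "Z \<in> {X + Y |X Y. X \<in> frame_span frame I \<and> Y \<in> frame_span frame J}"
  then show "Z \<in> {fr (\<lambda>p. x) |x. True}" by (auto simp: frame_span_eq fr_add)
next
  fix Z assume "Z \<in> {fr (\<lambda>p. x) |x. True}"
  then obtain x where Z: "Z = fr (\<lambda>p. x)" by blast
  define y z where "y = (\<chi> i. if i \<in> I then x $ i else 0)" and "z = x - y"
  have "Z = fr (\<lambda>p. y) + fr (\<lambda>p. z)" by (simp add: Z fr_add z_def)
  moreover have "fr (\<lambda>p. y) \<in> frame_span frame I"
    unfolding frame_span_eq by (auto simp: y_def intro!: exI[of _ y])
  moreover have "fr (\<lambda>p. z) \<in> frame_span frame J"
    unfolding frame_span_eq using assms by (auto simp: y_def z_def intro!: exI[of _ z])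
  ultimately show "Z \<in> {X + Y |X Y. X \<in> frame_span frame I \<and> Y \<in> frame_span frame J}" by blast
qed

text \<open>Left translations carry the frame to itself, so fields with constant coefficients are
  invariant by the chain rule. Conversely, an invariant field is determined by its value at the
  unit, which forces its coefficients to be constant.\<close>

lemma lie_algebra_eq:
  fixes G :: "(real^5) monoid" (structure)
  assumes G: "group G" "carrier G = UNIV"
    and smooth: "\<And>a. smooth_on UNIV (\<lambda>p. a \<otimes> p)"
    and invariant: "\<And>a p x. deriv_at (\<lambda>q. a \<otimes> q) p (\<Phi> p x) = \<Phi> (a \<otimes> p) x"
  shows "lie_algebra G std_atlas = {fr (\<lambda>p. x) |x. True}"
proof -
  have chain: "deriv_at (\<lambda>q. f (a \<otimes> q)) p v = deriv_at f (a \<otimes> p) (deriv_at (\<lambda>q. a \<otimes> q) p v)"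
    if "smooth_on UNIV f" for f :: "real^5 \<Rightarrow> real" and a p v
    using deriv_at_eq[OF diff_chain_at[OF smooth_has_derivative[OF smooth] smooth_has_derivative[OF that]]]
    by (simp add: o_def)
  have left: "fr x (\<lambda>p. f (a \<otimes> p)) p = deriv_at f (a \<otimes> p) (\<Phi> (a \<otimes> p) (x p))"
    if "smooth_on UNIV f" for f :: "real^5 \<Rightarrow> real" and x a p
    by (simp add: fr_smooth smooth_on_compose[OF that smooth] chain[OF that] invariant)
  show ?thesis
  proof (intro equalityI subsetI)
    fix X assume "X \<in> {fr (\<lambda>p. x) |x. True}"
    then obtain x where x: "X = fr (\<lambda>p. x)" by blast
    have "X (\<lambda>p. f (a \<otimes> p)) = (\<lambda>p. X f (a \<otimes> p))" if "smooth_on UNIV f" for f a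
      unfolding x by (rule ext) (simp only: left[OF that] fr_smooth[OF that])
    then show "X \<in> lie_algebra G std_atlas"
      by (simp add: lie_algebra_def smooth_functions_std x fr_in_vector_fields smooth_on_const)
  next
    fix X :: "(real^5) vfield" assume X: "X \<in> lie_algebra G std_atlas"
    then have "X \<in> vector_fields std_atlas" by (simp add: lie_algebra_def)
    then obtain x where x: "X = fr x" by (auto simp: vector_fields_fr)
    have "x a = x \<one>" for a
    proof -
      have one: "a \<otimes> \<one> = a" using monoid.r_one[OF group.is_monoid[OF G(1)]] G(2) by simp
      \<comment> \<open>Invariance under translation by a, tested on a linear function and evaluated
        at the unit.\<close>
      have "\<Phi> a (x \<one>) \<bullet> i = \<Phi> a (x a) \<bullet> i" for i
      proof -
        have bl: "bounded_linear (\<lambda>q::real^5. q \<bullet> i)" by (rule bounded_linear_inner_left)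
        note sm = smooth_on_bounded_linear[OF bl]
        have "fr x (\<lambda>p. (a \<otimes> p) \<bullet> i) = (\<lambda>p. fr x (\<lambda>q. q \<bullet> i) (a \<otimes> p))"
          using X sm by (auto simp: lie_algebra_def smooth_functions_std x)
        from fun_cong[OF this, of \<one>] show ?thesis
          by (simp add: left[OF sm] fr_smooth[OF sm] one deriv_at_bounded_linear[OF bl])
      qed
      then have "\<Phi> a (x \<one>) = \<Phi> a (x a)" by (metis vector_eq_rdot)
      then show ?thesis by (metis \<Theta>_\<Phi>)
    qed
    then have "X = fr (\<lambda>p. x \<one>)" unfolding x by (intro arg_cong[of _ _ fr]) auto
    then show "X \<in> {fr (\<lambda>p. x) |x. True}" by blast
  qed
qed

lemma adapted_frame_frame:
  fixes G :: "(real^5) monoid"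
  assumes "lie_algebra G std_atlas = {fr (\<lambda>p. x) |x. True}"
  shows "adapted_frame G std_atlas frame"
  unfolding adapted_frame_def assms
proof (intro conjI allI ballI)
  show "frame i \<in> {fr (\<lambda>p. x) |x. True}" for i by (auto simp: frame_def)
  fix X assume "X \<in> {fr (\<lambda>p. x) |x. True}"
  then obtain x where X: "X = fr (\<lambda>p. x)" by blast
  have "X = (\<Sum>i\<in>UNIV. (\<lambda>p. a i) \<bullet>\<^sub>f frame i) \<longleftrightarrow> a = (\<lambda>i. x $ i)" for a
  proof -
    have "(\<Sum>i\<in>UNIV. (\<lambda>p. a i) \<bullet>\<^sub>f frame i) = fr (\<lambda>p. vec_lambda a)"
      using sum_frame_UNIV[of "\<lambda>p. vec_lambda a"] by simp
    then show ?thesis unfolding X by (simp only: fr_inject) (auto simp: fun_eq_iff vec_eq_iff)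
  qed
  then show "\<exists>!a. X = (\<Sum>i\<in>UNIV. (\<lambda>p. a i) \<bullet>\<^sub>f frame i)" by simp
qed

end

section \<open>A Euclidean space with one global chart as a Lie group\<close>

lemma smooth_manifold_std: "smooth_manifold (euclidean :: 'a topology) (std_atlas :: ('a::euclidean_space, 'a) atlas)"
proof -
  have "second_countable (euclidean :: 'a topology)"
  proof -
    obtain B :: "'a set set" where B: "countable B" "topological_basis B"
      using ex_countable_basis by blast
    have "open U" if "U \<in> B" for U using B(2) that by (rule topological_basis_open)
    moreover have "\<exists>V\<in>B. x \<in> V \<and> V \<subseteq> U" if "open U" "x \<in> U" for U x
      using topological_basisE[OF B(2) that] by metis
    ultimately show ?thesis
      unfolding second_countable_def using B(1) by (intro exI[of _ B]) auto
  qed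
  then show ?thesis
    using homeomorphic_map_id[of euclidean euclidean] smooth_on_ident
    by (simp add: smooth_manifold_def o_def id_def)
qed

lemma lie_group_std:
  fixes G :: "'a::euclidean_space monoid" (structure)
  assumes "group G" "carrier G = UNIV"
    and mult: "smooth_on UNIV (\<lambda>(x, y). x \<otimes> y)" and inv: "smooth_on UNIV (\<lambda>x. inv x)"
  shows "lie_group G euclidean (std_atlas :: ('a, 'a) atlas)"
proof -
  have cont: "continuous_on UNIV f" if "smooth_on UNIV f" for f :: "'b::euclidean_space \<Rightarrow> 'a"
    using smooth_onD[OF that, of 0] by simp
  have "prod_atlas std_atlas std_atlas = (std_atlas :: ('a \<times> 'a, 'a \<times> 'a) atlas)"
    by (auto simp: prod_atlas_def map_prod_def id_def split_beta)
  moreover have "prod_topology euclidean euclidean = (euclidean :: ('a \<times> 'a) topology)"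
    by (rule prod_topology_euclidean)
  ultimately show ?thesis
    using cont[OF mult] cont[OF inv] mult inv
    by (simp add: lie_group_def assms(1,2) smooth_manifold_std smooth_map_def o_def)
qed

section \<open>The group\<close>

text \<open>In the coordinates \<open>(p$1, p$2, p$4; p$3, p$5)\<close> the group is the semidirect product of \<open>\<real>\<^sup>3\<close> with the
  affine group of the line, which acts on \<open>\<real>\<^sup>3\<close> through a twist of the symmetric square of its standard
  representation.\<close>

definition lmult :: "real^5 \<Rightarrow> real^5 \<Rightarrow> real^5" where
  "lmult p q = vec5
     (p$1 + exp (p$5)^2 * q$1)
     (p$2 + 2 * p$3 * exp (p$5)^2 * q$1 + exp (p$5) * q$2)
     (p$3 + exp (- p$5) * q$3)
     (p$4 + (p$3)^2 * exp (p$5)^2 * q$1 + p$3 * exp (p$5) * q$2 + q$4)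
     (p$5 + q$5)"

text \<open>The inverse in the affine group, together with minus its action on the
  \<open>\<real>\<^sup>3\<close> part.\<close>

definition linverse :: "real^5 \<Rightarrow> real^5" where
  "linverse p = vec5
     (- (exp (- p$5)^2 * p$1))
     (2 * p$3 * exp (- p$5) * p$1 - exp (- p$5) * p$2)
     (- (exp (p$5) * p$3))
     (p$3 * p$2 - (p$3)^2 * p$1 - p$4)
     (- p$5)"

definition L :: "(real^5) monoid" where
  "L = \<lparr>carrier = UNIV, mult = lmult, one = 0\<rparr>"

lemma L_simps: "carrier L = UNIV" "mult L = lmult" "one L = 0"
  by (simp_all add: L_def)

lemma lmult_assoc: "lmult (lmult p q) s = lmult p (lmult q s)"
  by (simp add: lmult_def vec5_eq_iff exp_add exp_diff exp_minus field_simps power2_eq_square)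

lemma lmult_zero: "lmult 0 p = p"
  by (simp add: lmult_def vec5_eq_iff)

lemma lmult_linverse: "lmult (linverse p) p = 0"
  by (simp add: lmult_def linverse_def vec5_eq_iff exp_minus field_simps power2_eq_square)

lemma group_L: "group L"
proof (rule groupI)
  fix p :: "real^5"
  show "\<exists>q\<in>carrier L. q \<otimes>\<^bsub>L\<^esub> p = \<one>\<^bsub>L\<^esub>"
    using lmult_linverse[of p] by (auto simp: L_simps)
qed (simp_all add: L_simps lmult_assoc lmult_zero)

lemma inv_L: "inv\<^bsub>L\<^esub> p = linverse p"
  using group.inv_equality[OF group_L, of "linverse p" p] by (simp add: L_simps lmult_linverse)

lemmas smooth_intros = smooth_on_add smooth_on_diff smooth_on_minus smooth_on_mult smooth_on_power
  smooth_on_exp smooth_on_vec_nth smooth_on_const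

lemma lie_group_L: "lie_group L euclidean std_atlas"
proof (rule lie_group_std[OF group_L])
  have "smooth_on UNIV (\<lambda>s. lmult (fst s) (snd s))"
    unfolding lmult_def
    by (intro smooth_on_vec5 smooth_intros smooth_on_bounded_linear[OF bounded_linear_fst]
        smooth_on_bounded_linear[OF bounded_linear_snd])
  then show "smooth_on UNIV (\<lambda>(p, q). p \<otimes>\<^bsub>L\<^esub> q)" by (simp add: L_simps case_prod_beta')
  show "smooth_on UNIV (\<lambda>p. inv\<^bsub>L\<^esub> p)"
    unfolding inv_L linverse_def by (intro smooth_on_vec5 smooth_intros smooth_on_ident)
qed (simp add: L_simps)

section \<open>The left-invariant frame\<close>

text \<open>\<open>\<mu>\<close> and \<open>\<nu>\<close> are the coefficients with respect to weight vectors \<open>U, V\<close> of \<open>ad e\<^sub>5\<close> for which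
  \<open>e\<^sub>1 = \<surd>3/2 (U - V/9)\<close>, \<open>e\<^sub>4 = (U - V)/2\<close>, \<open>[e\<^sub>5, U] = 2 U\<close>, \<open>[e\<^sub>3, U] = 2 e\<^sub>2\<close>, \<open>[e\<^sub>3, e\<^sub>2] = V\<close>, and \<open>V\<close>
  commutes with everything.\<close>

definition \<Phi> :: "real^5 \<Rightarrow> real^5 \<Rightarrow> real^5" where
  "\<Phi> p x = (let \<mu> = sqrt 3 / 2 * x$1 + x$4 / 2; \<nu> = - (sqrt 3 / 18 * x$1) - x$4 / 2 in vec5
     (exp (p$5)^2 * \<mu>)
     (2 * p$3 * exp (p$5)^2 * \<mu> + exp (p$5) * x$2)
     (exp (- p$5) * x$3)
     ((p$3)^2 * exp (p$5)^2 * \<mu> + p$3 * exp (p$5) * x$2 + \<nu>)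
     (x$5))"

text \<open>Undoes the group action, then returns to e1 and e4 through
  \<open>U = 3 * sqrt 3 / 4 e1 - e4 / 4\<close> and
  \<open>V = 3 * sqrt 3 / 4 e1 - 9 / 4 e4\<close>.\<close>

definition \<Theta> :: "real^5 \<Rightarrow> real^5 \<Rightarrow> real^5" where
  "\<Theta> p v = (let \<mu> = exp (- p$5)^2 * v$1; \<nu> = v$4 - p$3 * v$2 + (p$3)^2 * v$1 in vec5
     (3 * sqrt 3 / 4 * (\<mu> + \<nu>))
     (exp (- p$5) * (v$2 - 2 * p$3 * v$1))
     (exp (p$5) * v$3)
     (- (\<mu> + 9 * \<nu>) / 4)
     (v$5))"

text \<open>The relations between e3, e5, U, e2, V expanded in the frame; \<open>w i j\<close>
  multiplies the components of \<open>[e_i, e_j]\<close>. Every pair that occurs contains 3 or 5,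
  which reflects that h is abelian.\<close>

definition struct :: "real^5 \<Rightarrow> real^5 \<Rightarrow> real^5" where
  "struct x y = (let w = \<lambda>i j. x$i * y$j - x$j * y$i in vec5
     (- (9 / 4 * w 1 5) - 3 * sqrt 3 / 4 * (w 2 3 + w 4 5))
     (w 3 4 - sqrt 3 * w 1 3 - w 2 5)
     (w 3 5)
     (sqrt 3 / 4 * w 1 5 + 9 / 4 * w 2 3 + w 4 5 / 4)
     0)"

text \<open>Simplification nests products to the right, where \<open>sqrt 3 * sqrt 3\<close> need
  not occur as a subterm.\<close>

lemma sqrt3_cancel: "sqrt 3 * (sqrt 3 * t) = 3 * t"
  by (simp add: mult.assoc[symmetric])

lemma has_derivative_nth: "((\<lambda>p. p $ i) has_derivative (\<lambda>v. v $ i)) F"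
  by (rule bounded_linear_imp_has_derivative[OF bounded_linear_vec_nth])

lemma has_derivative_\<Phi>:
  "((\<lambda>q. \<Phi> q x) has_derivative (\<lambda>v. let \<mu> = sqrt 3 / 2 * x$1 + x$4 / 2 in vec5
     (2 * exp (p$5)^2 * \<mu> * v$5)
     (2 * exp (p$5)^2 * \<mu> * v$3 + 4 * p$3 * exp (p$5)^2 * \<mu> * v$5 + exp (p$5) * x$2 * v$5)
     (- (exp (- p$5) * x$3 * v$5))
     (2 * p$3 * exp (p$5)^2 * \<mu> * v$3 + 2 * (p$3)^2 * exp (p$5)^2 * \<mu> * v$5
       + exp (p$5) * x$2 * v$3 + p$3 * exp (p$5) * x$2 * v$5)
     0)) (at p)"
  unfolding \<Phi>_def Let_def
  by (rule has_derivative_vec5)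
    (auto intro!: derivative_eq_intros has_derivative_nth simp: fun_eq_iff power2_eq_square field_simps)

lemma has_derivative_lmult:
  "((\<lambda>q. lmult a q) has_derivative (\<lambda>v. vec5
     (exp (a$5)^2 * v$1)
     (2 * a$3 * exp (a$5)^2 * v$1 + exp (a$5) * v$2)
     (exp (- a$5) * v$3)
     ((a$3)^2 * exp (a$5)^2 * v$1 + a$3 * exp (a$5) * v$2 + v$4)
     (v$5))) (at p)"
  unfolding lmult_def
  by (rule has_derivative_vec5)
    (auto intro!: derivative_eq_intros has_derivative_nth simp: fun_eq_iff power2_eq_square field_simps)

interpretation L: global_frame \<Phi> \<Theta> struct
proof (rule global_frame.intro)
  show "linear (\<Phi> p)" for p
    by (rule linearI) (simp_all add: \<Phi>_def Let_def vec5_eq_iff field_simps)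
  show "\<Theta> p (\<Phi> p x) = x" for p x
    by (simp add: \<Phi>_def \<Theta>_def Let_def vec5_eq_iff exp_minus field_simps power2_eq_square sqrt3_cancel)
  show "\<Phi> p (\<Theta> p v) = v" for p v
    by (simp add: \<Phi>_def \<Theta>_def Let_def vec5_eq_iff exp_minus field_simps power2_eq_square sqrt3_cancel)
  show "smooth_on UNIV (\<lambda>p. \<Phi> p x)" for x
    unfolding \<Phi>_def Let_def by (intro smooth_on_vec5 smooth_intros smooth_on_ident)
  show "smooth_on UNIV (\<lambda>p. \<Theta> p v)" for v
    unfolding \<Theta>_def Let_def divide_inverse by (intro smooth_on_vec5 smooth_intros smooth_on_ident)
  \<comment> \<open>This matches the structure constants with the group law: \<open>struct\<close>
    is the bracket of fields with constant coefficients.\<close>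
  show "deriv_at (\<lambda>q. \<Phi> q y) p (\<Phi> p x) - deriv_at (\<lambda>q. \<Phi> q x) p (\<Phi> p y) = \<Phi> p (struct x y)" for p x y
    unfolding deriv_at_eq[OF has_derivative_\<Phi>]
    by (simp add: \<Phi>_def struct_def Let_def vec5_eq_iff exp_minus field_simps power2_eq_square sqrt3_cancel)
qed

lemma lie_algebra_L: "lie_algebra L std_atlas = {L.fr (\<lambda>p. x) |x. True}"
proof (rule L.lie_algebra_eq[OF group_L])
  show "smooth_on UNIV (\<lambda>p. a \<otimes>\<^bsub>L\<^esub> p)" for a
    unfolding L_simps lmult_def by (intro smooth_on_vec5 smooth_intros smooth_on_ident)
  \<comment> \<open>\<open>\<Phi> p\<close> is the change of basis \<open>\<Phi> 0\<close> followed
    by the differential at 0 of left translation by p. The claim is the chain rule for translation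
    by p followed by translation by a.\<close>
  show "deriv_at (\<lambda>q. a \<otimes>\<^bsub>L\<^esub> q) p (\<Phi> p x) = \<Phi> (a \<otimes>\<^bsub>L\<^esub> p) x" for a p x
    unfolding L_simps deriv_at_eq[OF has_derivative_lmult]
    by (simp add: lmult_def \<Phi>_def Let_def vec5_eq_iff exp_add exp_diff exp_minus field_simps power2_eq_square)
qed (simp add: L_simps)

section \<open>The characteristic connection and its torsion\<close>

text \<open>The skew endomorphisms dual to \<open>E\<^sub>1, E\<^sub>2, E\<^sub>3\<close>; they span the copy of \<open>so(3)\<close> that annihilates the cubic.\<close>

definition rot1 :: "real^5 \<Rightarrow> real^5" where
  "rot1 y = vec5 (sqrt 3 * y$5) (y$3) (- y$2) (y$5) (- (sqrt 3 * y$1) - y$4)"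

definition rot2 :: "real^5 \<Rightarrow> real^5" where
  "rot2 y = vec5 (sqrt 3 * y$3) (y$5) (y$4 - sqrt 3 * y$1) (- y$3) (- y$2)"

definition rot3 :: "real^5 \<Rightarrow> real^5" where
  "rot3 y = vec5 0 (2 * y$4) (y$5) (- (2 * y$2)) (- y$3)"

text \<open>With values in so(3), both the metric and the cubic are parallel; the weights of the
  three rotations are such that the torsion comes out totally skew. There is no term in
  \<open>x$5\<close>: the frame is parallel along e5.\<close>

definition char_coeff :: "real^5 \<Rightarrow> real^5 \<Rightarrow> real^5" where
  "char_coeff x y = (x$4 / 4 - 3 * sqrt 3 / 4 * x$1) *\<^sub>R rot1 y - x$2 *\<^sub>R rot2 y + x$3 *\<^sub>R rot3 y"

text \<open>The torsion form is \<open>\<surd>3 e\<^sup>1\<^sup>4\<^sup>5 + \<^sup>3/\<^sub>4 e\<^sup>2\<^sup>3\<^sup>4 - \<surd>3/4 e\<^sup>1\<^sup>2\<^sup>3\<close>.\<close>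

definition tors :: "real^5 \<Rightarrow> real^5 \<Rightarrow> real^5" where
  "tors x y = (let w = \<lambda>i j. x$i * y$j - x$j * y$i in vec5
     (sqrt 3 * w 4 5 - sqrt 3 / 4 * w 2 3)
     (3 / 4 * w 3 4 + sqrt 3 / 4 * w 1 3)
     (- (3 / 4 * w 2 4) - sqrt 3 / 4 * w 1 2)
     (3 / 4 * w 2 3 - sqrt 3 * w 1 5)
     (sqrt 3 * w 1 4))"

definition lc_coeff :: "real^5 \<Rightarrow> real^5 \<Rightarrow> real^5" where
  "lc_coeff x y = char_coeff x y - (1 / 2) *\<^sub>R tors x y"

lemmas rot_defs = rot1_def rot2_def rot3_def

lemma bounded_bilinear_tors: "bounded_bilinear tors"
  by (rule bounded_bilinearI) (simp_all add: tors_def Let_def vec5_eq_iff field_simps)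

lemma bounded_bilinear_char_coeff: "bounded_bilinear char_coeff"
  by (rule bounded_bilinearI) (simp_all add: char_coeff_def rot_defs vec5_eq_iff field_simps sqrt3_cancel)

lemma bounded_bilinear_lc_coeff: "bounded_bilinear lc_coeff"
proof -
  interpret t: bounded_bilinear tors by (rule bounded_bilinear_tors)
  interpret c: bounded_bilinear char_coeff by (rule bounded_bilinear_char_coeff)
  show ?thesis
    by (rule bounded_bilinearI)
      (simp_all add: lc_coeff_def t.add_left t.add_right t.scaleR_left t.scaleR_right
        c.add_left c.add_right c.scaleR_left c.scaleR_right algebra_simps)
qed

lemma tors_eq: "char_coeff x y - char_coeff y x - struct x y = tors x y"
  by (simp add: char_coeff_def rot_defs tors_def struct_def Let_def vec5_eq_iff field_simps sqrt3_cancel)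

lemma tors_skew: "tors y x = - tors x y" "tors x z \<bullet> y = - (tors x y \<bullet> z)"
  by (simp_all add: tors_def Let_def vec5_eq_iff inner_5 field_simps)

lemma rot_skew: "rot1 y \<bullet> z + y \<bullet> rot1 z = 0" "rot2 y \<bullet> z + y \<bullet> rot2 z = 0" "rot3 y \<bullet> z + y \<bullet> rot3 z = 0"
  by (simp_all add: rot_defs inner_5 algebra_simps)

lemma char_coeff_skew: "char_coeff x y \<bullet> z + y \<bullet> char_coeff x z = 0"
proof -
  have "char_coeff x y \<bullet> z + y \<bullet> char_coeff x z
      = (x$4 / 4 - 3 * sqrt 3 / 4 * x$1) * (rot1 y \<bullet> z + y \<bullet> rot1 z)
        - x$2 * (rot2 y \<bullet> z + y \<bullet> rot2 z) + x$3 * (rot3 y \<bullet> z + y \<bullet> rot3 z)"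
    by (simp add: char_coeff_def inner_add_left inner_add_right inner_diff_left inner_diff_right field_simps)
  then show ?thesis by (simp add: rot_skew)
qed

text \<open>Half of the torsion is totally skew, so subtracting it preserves compatibility with the
  metric.\<close>

lemma lc_coeff_skew: "lc_coeff x y \<bullet> z + y \<bullet> lc_coeff x z = 0"
  using char_coeff_skew[of x y z] tors_skew(2)[of x z y]
  by (simp add: lc_coeff_def inner_diff_left inner_diff_right inner_commute)

lemma polar_grad_rot:
  "rot1 x \<bullet> polar_grad y z + x \<bullet> polar_grad (rot1 y) z + x \<bullet> polar_grad y (rot1 z) = 0"
  "rot2 x \<bullet> polar_grad y z + x \<bullet> polar_grad (rot2 y) z + x \<bullet> polar_grad y (rot2 z) = 0"
  "rot3 x \<bullet> polar_grad y z + x \<bullet> polar_grad (rot3 y) z + x \<bullet> polar_grad y (rot3 z) = 0"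
  by (simp_all add: rot_defs polar_grad_def inner_5 field_simps sqrt3_cancel)

lemma polar_char_coeff:
  "polar (char_coeff w x) y z + polar x (char_coeff w y) z + polar x y (char_coeff w z) = 0"
proof -
  interpret bounded_bilinear polar_grad by (rule bounded_bilinear_polar_grad)
  have "polar (char_coeff w x) y z + polar x (char_coeff w y) z + polar x y (char_coeff w z)
      = (w$4 / 4 - 3 * sqrt 3 / 4 * w$1)
          * (rot1 x \<bullet> polar_grad y z + x \<bullet> polar_grad (rot1 y) z + x \<bullet> polar_grad y (rot1 z))
        - w$2 * (rot2 x \<bullet> polar_grad y z + x \<bullet> polar_grad (rot2 y) z + x \<bullet> polar_grad y (rot2 z))
        + w$3 * (rot3 x \<bullet> polar_grad y z + x \<bullet> polar_grad (rot3 y) z + x \<bullet> polar_grad y (rot3 z))"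
    by (simp add: char_coeff_def polar_eq_inner inner_add_left inner_add_right inner_diff_left inner_diff_right
        add_left add_right diff_left diff_right scaleR_left scaleR_right algebra_simps)
  then show ?thesis by (simp add: polar_grad_rot)
qed

section \<open>Near integrability, type and exterior derivative of the torsion\<close>

lemma levi_civita_L: "levi_civita std_atlas L.frame (L.conn lc_coeff)"
proof (rule L.levi_civita_conn[OF bounded_bilinear_lc_coeff lc_coeff_skew])
  fix x y
  have "lc_coeff x y - lc_coeff y x = struct x y + (char_coeff x y - char_coeff y x - struct x y) - tors x y"
    by (simp add: lc_coeff_def tors_skew(1)[of x y] scaleR_minus_right flip: scaleR_left_distrib)
  then show "lc_coeff x y - lc_coeff y x = struct x y" by (simp only: tors_eq) simp
qed

lemma nearly_integrable_L: "nearly_integrable std_atlas L.frame"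
proof (rule L.nearly_integrable_conn[OF levi_civita_L])
  fix x
  have "tors x x = 0" by (simp add: tors_def Let_def vec5_eq_iff)
  moreover have "polar (char_coeff x x) x x = 0"
  proof -
    \<comment> \<open>By symmetry the three summands of \<open>polar_char_coeff\<close> coincide, so
      each of them is zero.\<close>
    have "polar x (char_coeff x x) x = polar (char_coeff x x) x x" by (rule polar_commute)
    moreover have "polar x x (char_coeff x x) = polar x (char_coeff x x) x" by (rule polar_commute)
    ultimately show ?thesis using polar_char_coeff[of x x x x] by linarith
  qed
  ultimately show "polar (lc_coeff x x) x x = 0" by (simp add: lc_coeff_def)
qed

lemma characteristic_connection_L: "characteristic_connection std_atlas L.frame (L.conn char_coeff)"
proof (rule L.characteristic_connection_conn[OF bounded_bilinear_char_coeff char_coeff_skew polar_char_coeff])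
  show "(char_coeff x z - char_coeff z x - struct x z) \<bullet> y
      = - ((char_coeff x y - char_coeff y x - struct x y) \<bullet> z)" for x y z
    unfolding tors_eq by (rule tors_skew)
  show "(char_coeff y x - char_coeff x y - struct y x) \<bullet> z
      = - ((char_coeff x y - char_coeff y x - struct x y) \<bullet> z)" for x y z
    unfolding tors_eq by (simp add: tors_skew(1)[of x y])
qed

lemma torsion_form_L:
  "torsion_form L.frame (L.conn char_coeff) (L.fr (\<lambda>p. x)) (L.fr (\<lambda>p. y)) (L.fr (\<lambda>p. z)) = (\<lambda>p. tors x y \<bullet> z)"
  by (simp add: L.torsion_form_conn smooth_on_const tors_eq)

lemma type_Lambda2_7_L: "type_Lambda2_7 std_atlas L.frame (torsion_form L.frame (L.conn char_coeff))"
\<comment> \<open>Only the equation for E1 has nonzero terms: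
  \<open>sqrt 3 * (3 / 4) = sqrt 3 - sqrt 3 / 4\<close>. The indices 1, 4, 5 pick the coefficient
  \<open>sqrt 3\<close>, which shows that the torsion is nonzero.\<close>
proof (rule L.type_Lambda2_7_const[where i = 1 and j = 4 and k = 5])
  show "torsion_form L.frame (L.conn char_coeff) (L.frame i) (L.frame j) (L.frame k)
      = (\<lambda>p. tors (axis i 1) (axis j 1) \<bullet> axis k 1)" for i j k
    by (simp add: L.frame_def torsion_form_L)
qed (simp_all add: tors_def Let_def inner_5 axis_def)

lemma not_closed3_L: "\<not> closed3 std_atlas (torsion_form L.frame (L.conn char_coeff))"
  \<comment> \<open>On e1, e2, e3, e5 the derivative is \<open>3 * sqrt 3 / 2\<close>: the bracket
    of e1, e5 contributes \<open>- 3 * sqrt 3 / 4\<close>, that of e2, e3 contributes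
    \<open>9 * sqrt 3 / 4\<close>, and those of e2, e5 and e3, e5 cancel.\<close>
  by (rule L.not_closed3_const[where t = "\<lambda>x y z. tors x y \<bullet> z"
        and w = "axis 1 1" and x = "axis 2 1" and y = "axis 3 1" and z = "axis 5 1", OF torsion_form_L])
    (simp add: tors_def struct_def Let_def inner_5 axis_def)

(* The charts take values in real^5, so the Lie group has dimension 5. As a mere set it is taken to
   be the type real^5, which has the cardinality of every connected 5-dimensional Lie group; its
   topology, atlas and multiplication are arbitrary. *)
theorem mainTheorem3:
  "\<exists>(L :: (real^5) monoid) (\<tau> :: (real^5) topology) (A :: (real^5, real^5) atlas)
     (e :: 5 \<Rightarrow> (real^5) vfield) (D :: (real^5) conn).
     lie_group L \<tau> A \<and> connected_space \<tau> \<and>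
     adapted_frame L A e \<and> nearly_integrable A e \<and>
     characteristic_connection A e D \<and>
     type_Lambda2_7 A e (torsion_form e D) \<and>
     \<not> closed3 A (torsion_form e D) \<and>
     lie_algebra L A = {X + Y |X Y. X \<in> frame_span e {1, 2, 4} \<and> Y \<in> frame_span e {3, 5}} \<and>
     frame_span e {1, 2, 4} \<inter> frame_span e {3, 5} = {0} \<and>
     bracket_in (frame_span e {3, 5}) (frame_span e {3, 5}) (frame_span e {3, 5}) \<and>
     bracket_in (frame_span e {1, 2, 4}) (frame_span e {3, 5}) (frame_span e {1, 2, 4}) \<and>
     bracket_in (frame_span e {1, 2, 4}) (frame_span e {1, 2, 4}) (frame_span e {3, 5})"
proof (intro exI conjI)
  show "lie_group L euclidean std_atlas" by (rule lie_group_L)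
  show "connected_space (euclidean :: (real^5) topology)" by (metis connected_UNIV connectedin_iff_connected connectedin_topspace topspace_euclidean)
  show "adapted_frame L std_atlas L.frame" by (rule L.adapted_frame_frame[OF lie_algebra_L])
  show "nearly_integrable std_atlas L.frame" by (rule nearly_integrable_L)
  show "characteristic_connection std_atlas L.frame (L.conn char_coeff)" by (rule characteristic_connection_L)
  show "type_Lambda2_7 std_atlas L.frame (torsion_form L.frame (L.conn char_coeff))" by (rule type_Lambda2_7_L)
  show "\<not> closed3 std_atlas (torsion_form L.frame (L.conn char_coeff))" by (rule not_closed3_L)
  have "i \<in> {1, 2, 4} \<union> {3, 5}" for i :: 5 using exhaust_5[of i] by auto
  then have "{1, 2, 4} \<union> {3, 5} = (UNIV :: 5 set)" by blast
  then show "lie_algebra L std_atlas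
      = {X + Y |X Y. X \<in> frame_span L.frame {1, 2, 4} \<and> Y \<in> frame_span L.frame {3, 5}}"
    by (simp only: L.frame_span_add lie_algebra_L)
  show "frame_span L.frame {1, 2, 4} \<inter> frame_span L.frame {3, 5} = {0}"
    by (rule L.frame_span_Int) simp
  \<comment> \<open>Explicit complements turn each inclusion into finitely many coordinates of
    \<open>struct x y\<close>, all of whose products contain a vanishing factor.\<close>
  have outside: "i \<notin> {3, 5} \<longleftrightarrow> i = 1 \<or> i = 2 \<or> i = 4" "i \<notin> {1, 2, 4} \<longleftrightarrow> i = 3 \<or> i = 5" for i :: 5
    using exhaust_5[of i] by auto
  show "bracket_in (frame_span L.frame {3, 5}) (frame_span L.frame {3, 5}) (frame_span L.frame {3, 5})"
    by (rule L.bracket_in_frame_span) (auto simp only: outside struct_def Let_def; simp)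
  show "bracket_in (frame_span L.frame {1, 2, 4}) (frame_span L.frame {3, 5}) (frame_span L.frame {1, 2, 4})"
    by (rule L.bracket_in_frame_span) (auto simp only: outside struct_def Let_def; simp)
  show "bracket_in (frame_span L.frame {1, 2, 4}) (frame_span L.frame {1, 2, 4}) (frame_span L.frame {3, 5})"
    by (rule L.bracket_in_frame_span) (auto simp only: outside struct_def Let_def; simp)
qed

end
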